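(* Let $p$ be a prime. For every $a,b,c,d\in \mathbb{N}_0$ we have $$N(p^a,p^b,p^c,p^d)= \sum \varphi(p^{x_3})\, \varphi(p^{y_3})\, \varphi(p^{z_3})\, \varphi(p^{t_3})\, F(p^u,p^v),$$ where the sum is over all 20-tuples $$(x_1,x_2,x_3,x_4,x_5,\,y_1,y_2,y_3,y_4,y_5,\,z_1,z_2,z_3,z_4,z_5,\,t_1,t_2,t_3,t_4,t_5)\in \mathbb{N}_0^{20}$$ satisfying the following 10 conditions, the last two of which also define $u$ and $v$: (i) $x_1+x_2+x_3=a$; (ii) $x_3+x_4+x_5=b$; (iii) $y_1+y_2+y_3=\min(x_1,x_4)$; (iv) $y_3+y_4+y_5=x_3+\max(x_1,x_4)$; (v) $z_1+z_2+z_3=c$; (vi) $z_3+z_4+z_5=d$; (vii) $t_1+t_2+t_3=\min(z_1,z_4)$; (viii) $t_3+t_4+t_5=z_3+\max(z_1,z_4)$; (ix) $\min(y_2,y_5)=\min(t_2,t_5)=:u$; (x) $y_3+\max(y_2,y_5)= t_3+ \max(t_2,t_5)=:v$.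
   Context: $\mathbb{N}=\{1,2,\ldots\}$ and $\mathbb{N}_0=\mathbb{N}\cup\{0\}$. $\mathbb{Z}_n$ denotes the additive group of residue classes modulo $n$. For $m,n,r,s\in\mathbb{N}$, $N(m,n,r,s)$ denotes the total number of subgroups of the group $\mathbb{Z}_m\times\mathbb{Z}_n\times\mathbb{Z}_r\times\mathbb{Z}_s$. $\varphi$ is Euler's totient function. For $m,n\in\mathbb{N}$, $F(m,n)$ denotes the number of automorphisms of the group $\mathbb{Z}_m\times\mathbb{Z}_n$. *)

theory Defs
  imports "HOL-Algebra.Elementary_Groups" "HOL-Algebra.Bij" "HOL-Number_Theory.Totient"
begin

(* integer_mod_group n is the residue group Z_n for n > 0, but integer_mod_group 0 is the
   infinite group of integers; so the two counts below have their intended meaning for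
   positive arguments only. *)

definition num_subgroups4 :: "nat \<Rightarrow> nat \<Rightarrow> nat \<Rightarrow> nat \<Rightarrow> nat" where
  "num_subgroups4 m n r s =
     card {H. subgroup H (integer_mod_group m \<times>\<times> integer_mod_group n
                            \<times>\<times> integer_mod_group r \<times>\<times> integer_mod_group s)}"

(* auto G consists of the bijective endomorphisms that are extensional, i.e. undefined outside
   carrier G, so each automorphism is counted exactly once. *)
definition num_automorphisms2 :: "nat \<Rightarrow> nat \<Rightarrow> nat" where
  "num_automorphisms2 m n = card (auto (integer_mod_group m \<times>\<times> integer_mod_group n))"

end

theory Submission
  imports Defs
begin

text \<open>
  By Goursat's lemma, a subgroup of \<open>G \<times> H\<close> amounts to a chain \<open>K2 \<le> K1 \<le> G\<close>, a chain
  \<open>L2 \<le> L1 \<le> H\<close> and an isomorphism from \<open>K1 / K2\<close> to \<open>L1 / L2\<close>; if these quotients are isomorphic,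
  there are as many isomorphisms as automorphisms of one of them. Take for \<open>G\<close> and \<open>H\<close> the products
  of the first two and of the last two cyclic groups. Pulling the subgroups of
  \<open>Z_{p^a} \<times> Z_{p^b}\<close> back to sublattices of \<open>Z \<times> Z\<close> shows that they are parametrised by tuples
  \<open>(x1, x2, x3, x4, x5)\<close> with \<open>x1 + x2 + x3 = a\<close> and \<open>x3 + x4 + x5 = b\<close> together with a unit \<open>w\<close>
  modulo \<open>p^x3\<close>. The subgroup is isomorphic to the product of cyclic groups of orders
  \<open>p^(min x1 x4)\<close> and \<open>p^(x3 + max x1 x4)\<close>, and its quotient to the product of cyclic groups of
  orders \<open>p^(min x2 x5)\<close> and \<open>p^(x3 + max x2 x5)\<close>. Using this parametrisation twice counts the
  chains with a given isomorphism type of the top quotient, and this type is determined by the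
  order and the exponent.
\<close>

section \<open>Quotients of the integer lattice\<close>

lemma (in comm_group) subgroup_imp_comm_group:
  assumes "subgroup K G"
  shows "comm_group (G\<lparr>carrier := K\<rparr>)"
proof (rule group.group_comm_groupI)
  show "group (G\<lparr>carrier := K\<rparr>)"
    using assms by (rule subgroup_imp_group)
  show "x \<otimes>\<^bsub>G\<lparr>carrier := K\<rparr>\<^esub> y = y \<otimes>\<^bsub>G\<lparr>carrier := K\<rparr>\<^esub> x"
    if "x \<in> carrier (G\<lparr>carrier := K\<rparr>)" "y \<in> carrier (G\<lparr>carrier := K\<rparr>)" for x y
    using that subgroup.subset[OF assms] by (auto intro: m_comm)
qed

text \<open>
  The map \<open>f\<close> exhibits \<open>G\<close>, written multiplicatively, as the quotient of the additive group
  of pairs of integers by the lattice of all \<open>(i, j)\<close> with \<open>m dvd i\<close> and \<open>n dvd j\<close>.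
\<close>

locale presentation = comm_group G for G (structure) +
  fixes f :: "int \<Rightarrow> int \<Rightarrow> 'a" and m n :: int
  assumes f_closed [simp, intro]: "f i j \<in> carrier G"
    and f_add: "f (i + i') (j + j') = f i j \<otimes> f i' j'"
    and f_surj: "x \<in> carrier G \<Longrightarrow> \<exists>i j. x = f i j"
    and f_one_iff: "f i j = \<one> \<longleftrightarrow> m dvd i \<and> n dvd j"
begin

lemma f_zero [simp]: "f 0 0 = \<one>"
  by (simp add: f_one_iff)

lemma f_minus: "f (- i) (- j) = inv (f i j)"
proof -
  have "f (- i) (- j) \<otimes> f i j = \<one>"
    by (simp flip: f_add)
  then show ?thesis
    by (simp add: inv_equality)
qed

lemma f_eq_iff: "f i j = f i' j' \<longleftrightarrow> m dvd i - i' \<and> n dvd j - j'"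
proof -
  have "f (i - i') (j - j') = f i j \<otimes> inv (f i' j')"
    using f_add[of i "- i'" j "- j'"] by (simp add: f_minus)
  then have "f (i - i') (j - j') = \<one> \<longleftrightarrow> f i j = f i' j'"
    by (metis f_closed inv_closed inv_equality inv_inv r_inv)
  then show ?thesis
    by (simp add: f_one_iff)
qed

lemma f_diff: "f (i - i') (j - j') = f i j \<otimes> inv (f i' j')"
  using f_add[of i "- i'" j "- j'"] by (simp add: f_minus)

lemma f_int_pow: "f (k * i) (k * j) = f i j [^] k"
proof -
  have nat: "f (int n * i) (int n * j) = f i j [^] n" for n
    by (induction n) (simp_all add: distrib_right m_comm f_add)
  show ?thesis
    by (cases k rule: int_cases2) (simp_all add: nat int_pow_int int_pow_neg_int f_minus)
qed

lemma presentation_swap: "presentation G (\<lambda>i j. f j i) n m"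
proof
  show "\<exists>i j. x = f j i" if "x \<in> carrier G" for x
    using f_surj[OF that] by blast
qed (auto simp: f_add f_one_iff)

end

text \<open>The existential hides the generators, so subgroups, quotients and products of cyclic
  groups, whose elements have different HOL types, are compared by two integers alone. The pair is
  not canonical: neither entry has to divide the other, and a trivial factor appears as entry
  1.\<close>

definition has_type :: "('a, 'b) monoid_scheme \<Rightarrow> int \<Rightarrow> int \<Rightarrow> bool" where
  "has_type G m n \<longleftrightarrow> (\<exists>f. presentation G f m n)"

lemma has_type_swap: "has_type G m n \<longleftrightarrow> has_type G n m"
  unfolding has_type_def using presentation.presentation_swap by blast

text \<open>
  Every lattice that contains a multiple of each coordinate vector, all relevant indices being
  powers of one prime, is of this shape with \<open>w\<close> invertible modulo \<open>q\<close>: \<open>A\<close> and \<open>B\<close> generate its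
  two projections, \<open>A * q\<close> and \<open>B * q\<close> its intersections with the axes.
\<close>

definition glue_lattice :: "int \<Rightarrow> int \<Rightarrow> int \<Rightarrow> int \<Rightarrow> (int \<times> int) set" where
  "glue_lattice A q B w = {(A * k, B * l) |k l. [l = w * k] (mod q)}"

lemma glue_latticeI:
  "i = A * k \<Longrightarrow> j = B * l \<Longrightarrow> [l = w * k] (mod q) \<Longrightarrow> (i, j) \<in> glue_lattice A q B w"
  by (auto simp: glue_lattice_def)

lemma glue_latticeE:
  assumes "(i, j) \<in> glue_lattice A q B w"
  obtains k l where "i = A * k" "j = B * l" "[l = w * k] (mod q)"
  using assms by (auto simp: glue_lattice_def)

lemma glue_lattice_mult_iff:
  assumes "A \<noteq> 0" "B \<noteq> 0"
  shows "(A * k, B * l) \<in> glue_lattice A q B w \<longleftrightarrow> [l = w * k] (mod q)"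
  using assms by (auto simp: glue_lattice_def)

text \<open>Multiplying the gluing congruence by \<open>w'\<close> solves it for \<open>k\<close>:
  exchanging the coordinates inverts the gluing map.\<close>

lemma glue_lattice_swap_aux:
  assumes "[w * w' = 1] (mod q)" "(i, j) \<in> glue_lattice A q B w"
  shows "(j, i) \<in> glue_lattice B q A w'"
proof -
  from assms(2) obtain k l where kl: "i = A * k" "j = B * l" "[l = w * k] (mod q)"
    by (auto simp: glue_lattice_def)
  have "[w' * l = w' * (w * k)] (mod q)"
    using kl(3) by (rule cong_scalar_left)
  also have "w' * (w * k) = (w * w') * k"
    by simp
  also have "[(w * w') * k = 1 * k] (mod q)"
    using assms(1) by (rule cong_scalar_right)
  finally have "[k = w' * l] (mod q)"
    by (simp add: cong_sym)
  with kl show ?thesis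
    by (auto simp: glue_lattice_def)
qed

lemma glue_lattice_swap:
  assumes "[w * w' = 1] (mod q)"
  shows "(i, j) \<in> glue_lattice A q B w \<longleftrightarrow> (j, i) \<in> glue_lattice B q A w'"
  using glue_lattice_swap_aux[of w w'] glue_lattice_swap_aux[of w' w] assms
  by (metis mult.commute)

context presentation
begin

text \<open>
  The shear \<open>(i, j) \<mapsto> (i, j + w * C * i)\<close> diagonalises the lattice when \<open>B = A * C\<close>; the case
  \<open>B dvd A\<close> follows by exchanging the coordinates.
\<close>

lemma has_type_quotient_aux:
  assumes K: "subgroup K G" and fK: "\<And>i j. f i j \<in> K \<longleftrightarrow> (i, j) \<in> glue_lattice A q B w"
    and "A dvd B" "B \<noteq> 0"
  shows "has_type (G Mod K) A (q * B)"
proof -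
  interpret N: normal K G
    using K by (rule subgroup_imp_normal)
  interpret Q: comm_group "G Mod K"
    using K by (rule abelian_FactGroup)
  obtain C where C: "B = A * C"
    using \<open>A dvd B\<close> by auto
  define g where "g i j = K #> f i (j + w * C * i)" for i j
  have "presentation (G Mod K) g A (q * B)"
  proof
    show "g i j \<in> carrier (G Mod K)" for i j
      by (auto simp: g_def carrier_FactGroup)
    show "g (i + i') (j + j') = g i j \<otimes>\<^bsub>G Mod K\<^esub> g i' j'" for i i' j j'
    proof -
      have "g (i + i') (j + j') = K #> f (i + i') ((j + w * C * i) + (j' + w * C * i'))"
        by (simp add: g_def algebra_simps)
      also have "\<dots> = K #> (f i (j + w * C * i) \<otimes> f i' (j' + w * C * i'))"
        by (simp only: f_add)
      finally show ?thesis
        by (simp add: g_def N.rcos_sum)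
    qed
    show "\<exists>i j. x = g i j" if x: "x \<in> carrier (G Mod K)" for x
    proof -
      from x obtain y where "y \<in> carrier G" "x = K #> y"
        by (auto simp: carrier_FactGroup)
      moreover then obtain i j where "y = f i j"
        using f_surj by blast
      ultimately have "x = g i (j - w * C * i)"
        by (simp add: g_def)
      then show ?thesis by blast
    qed
    show "g i j = \<one>\<^bsub>G Mod K\<^esub> \<longleftrightarrow> A dvd i \<and> q * B dvd j" for i j
    proof -
      have "g i j = \<one>\<^bsub>G Mod K\<^esub> \<longleftrightarrow> f i (j + w * C * i) \<in> K"
        using coset_join1[OF _ _ K] coset_join2[OF _ K] by (auto simp: g_def)
      also have "\<dots> \<longleftrightarrow> A dvd i \<and> q * B dvd j"
      proof
        assume "f i (j + w * C * i) \<in> K"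
        then obtain k l where kl: "i = A * k" "j + w * C * i = B * l" "[l = w * k] (mod q)"
          by (auto simp: fK glue_lattice_def)
        \<comment> \<open>With \<open>B = A * C\<close> and \<open>i = A * k\<close>, the shear term
          \<open>w * C * i\<close> is \<open>B * (w * k)\<close>, so the gluing congruence becomes
          divisibility of \<open>j\<close> by \<open>q * B\<close>.\<close>
        have "j = B * (l - w * k)"
          using kl by (simp add: C algebra_simps)
        with kl show "A dvd i \<and> q * B dvd j"
          by (auto simp: cong_iff_dvd_diff mult.commute)
      next
        assume "A dvd i \<and> q * B dvd j"
        then obtain k l where kl: "i = A * k" "j = q * B * l"
          by blast
        have "j + w * C * i = B * (q * l + w * k)" "[q * l + w * k = w * k] (mod q)"
          using kl by (simp_all add: C algebra_simps cong_iff_dvd_diff)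
        then show "f i (j + w * C * i) \<in> K"
          unfolding fK glue_lattice_def using kl by blast
      qed
      finally show ?thesis .
    qed
  qed
  then show ?thesis
    by (auto simp: has_type_def)
qed

text \<open>The vectors \<open>(A, B * w)\<close> and \<open>(0, B * q)\<close> form a basis of the
  lattice, and \<open>g\<close> uses coordinates in this basis. An element with coordinates
  \<open>k\<close>, \<open>l\<close> is trivial iff \<open>q * C\<close> divides \<open>k\<close>
  and \<open>q * D\<close> divides \<open>w * k + q * l\<close>. Since \<open>D dvd C\<close>, the
  first condition already makes \<open>w * k\<close> a multiple of \<open>q * D\<close>, which
  leaves \<open>D dvd l\<close>.\<close>

lemma has_type_subgroup_aux:
  assumes K: "subgroup K G" and fK: "K = {f i j |i j. (i, j) \<in> glue_lattice A q B w}"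
    and m: "m = A * q * C" and n: "n = B * q * D" and "D dvd C" "A \<noteq> 0" "B \<noteq> 0" "q \<noteq> 0"
  shows "has_type (G\<lparr>carrier := K\<rparr>) (q * C) D"
proof -
  interpret K: comm_group "G\<lparr>carrier := K\<rparr>"
    using K by (rule subgroup_imp_comm_group)
  define g where "g k l = f (A * k) (B * (w * k + q * l))" for k l
  have "presentation (G\<lparr>carrier := K\<rparr>) g (q * C) D"
  proof
    show "g i j \<in> carrier (G\<lparr>carrier := K\<rparr>)" for i j
    proof -
      have "[w * i + q * j = w * i] (mod q)"
        by (simp add: cong_iff_dvd_diff)
      then show ?thesis
        by (auto simp: g_def fK glue_lattice_def)
    qed
    show "g (i + i') (j + j') = g i j \<otimes>\<^bsub>G\<lparr>carrier := K\<rparr>\<^esub> g i' j'" for i i' j j'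
      by (simp add: g_def algebra_simps flip: f_add)
    show "\<exists>i j. x = g i j" if "x \<in> carrier (G\<lparr>carrier := K\<rparr>)" for x
    proof -
      from that obtain k l where kl: "x = f (A * k) (B * l)" "[l = w * k] (mod q)"
        by (auto simp: fK glue_lattice_def)
      from kl(2) obtain r where "l - w * k = q * r"
        by (auto simp: cong_iff_dvd_diff)
      then have "l = w * k + q * r" by simp
      with kl show ?thesis by (auto simp: g_def)
    qed
    show "g i j = \<one>\<^bsub>G\<lparr>carrier := K\<rparr>\<^esub> \<longleftrightarrow> q * C dvd i \<and> D dvd j" for i j
    proof -
      have "g i j = \<one>\<^bsub>G\<lparr>carrier := K\<rparr>\<^esub> \<longleftrightarrow> q * C dvd i \<and> q * D dvd w * i + q * j"
        using assms by (simp add: g_def f_one_iff mult.assoc)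
      also have "\<dots> \<longleftrightarrow> q * C dvd i \<and> D dvd j"
      proof (intro conj_cong refl)
        assume "q * C dvd i"
        then have "q * D dvd w * i"
          using \<open>D dvd C\<close> by (meson dvd_mult dvd_refl dvd_trans mult_dvd_mono)
        then have "q * D dvd w * i + q * j \<longleftrightarrow> q * D dvd q * j"
          by (simp add: dvd_add_right_iff)
        then show "q * D dvd w * i + q * j \<longleftrightarrow> D dvd j"
          using \<open>q \<noteq> 0\<close> by simp
      qed
      finally show ?thesis .
    qed
  qed
  then show ?thesis
    by (auto simp: has_type_def)
qed

end

section \<open>Subgroups of a product of two cyclic p-groups\<close>

definition index_tuples :: "nat \<Rightarrow> nat \<Rightarrow> (nat \<times> nat \<times> nat \<times> nat \<times> nat) set" where
  "index_tuples a b = {(x1, x2, x3, x4, x5). x1 + x2 + x3 = a \<and> x3 + x4 + x5 = b}"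

lemma finite_index_tuples [simp]: "finite (index_tuples a b)"
proof (rule finite_subset)
  show "index_tuples a b \<subseteq> {..a} \<times> {..a} \<times> {..a} \<times> {..b} \<times> {..b}"
    by (auto simp: index_tuples_def)
qed auto

section \<open>Subgroups of the integers\<close>

lemma multiple_mem_if_diff_closed:
  fixes S :: "int set"
  assumes diff: "\<And>x y. x \<in> S \<Longrightarrow> y \<in> S \<Longrightarrow> x - y \<in> S" and x: "x \<in> S"
  shows "k * x \<in> S"
proof -
  have 0: "0 \<in> S"
    using diff[OF x x] by simp
  have minus: "- y \<in> S" if "y \<in> S" for y
    using diff[OF 0 that] by simp
  have nat: "int j * x \<in> S" for j
  proof (induction j)
    case (Suc j)
    then show ?case
      using diff[OF Suc minus[OF x]] by (simp add: algebra_simps)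
  qed (use 0 in simp)
  show ?thesis
    using nat minus[OF nat] by (cases k rule: int_cases2) simp_all
qed

text \<open>Take the least \<open>e\<close> with \<open>p ^ e\<close> in \<open>S\<close>. For
  \<open>x\<close> in \<open>S\<close>, Bezout puts the gcd of \<open>x\<close> and
  \<open>p ^ e\<close> into \<open>S\<close>; as a divisor of \<open>p ^ e\<close> it is a power of
  \<open>p\<close>, and minimality of \<open>e\<close> makes it a multiple of
  \<open>p ^ e\<close>.\<close>

lemma int_subgroup_containing_prime_power:
  fixes S :: "int set"
  assumes "prime p" and diff: "\<And>x y. x \<in> S \<Longrightarrow> y \<in> S \<Longrightarrow> x - y \<in> S"
    and a: "int p ^ a \<in> S"
  obtains e where "e \<le> a" "\<And>x. x \<in> S \<longleftrightarrow> int p ^ e dvd x"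
proof
  define e where "e = (LEAST e. int p ^ e \<in> S)"
  have e: "int p ^ e \<in> S"
    unfolding e_def using a by (rule LeastI)
  show "e \<le> a"
    unfolding e_def using a by (rule Least_le)
  note mult = multiple_mem_if_diff_closed[OF diff]
  show "x \<in> S \<longleftrightarrow> int p ^ e dvd x" for x
  proof
    assume x: "x \<in> S"
    obtain u v where uv: "u * x + v * int p ^ e = gcd x (int p ^ e)"
      using bezout_int by blast
    \<comment> \<open>The double sign turns the Bezout sum into a difference, the operation under
      which \<open>S\<close> is assumed closed.\<close>
    have "u * x - (- v) * int p ^ e \<in> S"
      using diff mult x e by blast
    then have g: "gcd x (int p ^ e) \<in> S"
      using uv by simp
    have "gcd x (int p ^ e) dvd int p ^ e"
      by simp
    moreover have "prime (int p)"
      using \<open>prime p\<close> by simp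
    ultimately obtain i where "normalize (gcd x (int p ^ e)) = int p ^ i"
      by (elim divides_primepow)
    then have i: "gcd x (int p ^ e) = int p ^ i"
      by simp
    with g have "e \<le> i"
      unfolding e_def by (auto intro: Least_le)
    then have "int p ^ e dvd gcd x (int p ^ e)"
      by (simp add: i le_imp_power_dvd)
    then show "int p ^ e dvd x"
      by simp
  next
    assume "int p ^ e dvd x"
    then obtain k where "x = k * int p ^ e"
      by (metis dvd_def mult.commute)
    then show "x \<in> S"
      using mult e by simp
  qed
qed

locale p_presentation = presentation G f "int p ^ a" "int p ^ b"
  for G (structure) and f and p a b :: nat +
  assumes prime_p: "prime p"
begin

text \<open>
  For the subgroup with index tuple \<open>(x1, x2, x3, x4, x5)\<close>, the intersections with the two factors
  have orders \<open>p ^ x1\<close> and \<open>p ^ x4\<close>, the projections have indices \<open>p ^ x2\<close> and \<open>p ^ x5\<close>, and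
  \<open>w\<close> is the gluing isomorphism between the resulting cyclic subquotients of order \<open>p ^ x3\<close>.
\<close>

definition glued_subgroup :: "nat \<times> nat \<times> nat \<times> nat \<times> nat \<Rightarrow> nat \<Rightarrow> 'a set" where
  "glued_subgroup = (\<lambda>(x1, x2, x3, x4, x5) w.
     {f i j |i j. (i, j) \<in> glue_lattice (int p ^ x2) (int p ^ x3) (int p ^ x5) (int w)})"

lemma p_pos [simp]: "p > 0" "p \<noteq> 0"
  using prime_gt_0_nat[OF prime_p] by simp_all

lemma p_power_neq_0 [simp]: "int p ^ k \<noteq> 0"
  using prime_p by auto

text \<open>As \<open>f\<close> is not injective, membership of \<open>f i j\<close> provides only
  some other pair in the lattice. The index equations place the kernel of \<open>f\<close> inside
  the lattice, so the choice of preimage does not matter.\<close>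

lemma f_mem_glued_subgroup_iff:
  assumes "(x1, x2, x3, x4, x5) \<in> index_tuples a b"
  shows "f i j \<in> glued_subgroup (x1, x2, x3, x4, x5) w \<longleftrightarrow>
    (i, j) \<in> glue_lattice (int p ^ x2) (int p ^ x3) (int p ^ x5) (int w)"
proof
  assume "f i j \<in> glued_subgroup (x1, x2, x3, x4, x5) w"
  then obtain k l where kl: "f i j = f (int p ^ x2 * k) (int p ^ x5 * l)"
    "[l = int w * k] (mod int p ^ x3)"
    by (auto simp: glued_subgroup_def glue_lattice_def)
  then have "int p ^ a dvd i - int p ^ x2 * k" "int p ^ b dvd j - int p ^ x5 * l"
    by (simp_all add: f_eq_iff)
  then obtain r s where "i - int p ^ x2 * k = int p ^ a * r" "j - int p ^ x5 * l = int p ^ b * s"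
    by (elim dvdE)
  moreover have "a = x2 + (x1 + x3)" "b = x5 + (x3 + x4)"
    using assms by (auto simp: index_tuples_def)
  ultimately have ij: "i = int p ^ x2 * (k + int p ^ (x1 + x3) * r)"
    "j = int p ^ x5 * (l + int p ^ (x3 + x4) * s)"
    by (simp_all add: algebra_simps power_add)
  \<comment> \<open>The corrections to \<open>k\<close> and \<open>l\<close> are multiples of
    \<open>p ^ x3\<close>, so they do not affect the gluing congruence.\<close>
  have "[int p ^ (x3 + x4) * s = int w * (int p ^ (x1 + x3) * r)] (mod int p ^ x3)"
    by (rule cong_trans[of _ 0]) (simp_all add: cong_0_iff cong_sym_eq[of 0] power_add)
  then have "[l + int p ^ (x3 + x4) * s = int w * (k + int p ^ (x1 + x3) * r)] (mod int p ^ x3)"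
    using cong_add[OF kl(2)] by (simp add: distrib_left)
  with ij show "(i, j) \<in> glue_lattice (int p ^ x2) (int p ^ x3) (int p ^ x5) (int w)"
    by (rule glue_latticeI)
qed (auto simp: glued_subgroup_def)

lemma subgroup_glued_subgroup: "subgroup (glued_subgroup x w) G"
proof -
  obtain x1 x2 x3 x4 x5 where x: "x = (x1, x2, x3, x4, x5)"
    by (cases x)
  define L where "L = glue_lattice (int p ^ x2) (int p ^ x3) (int p ^ x5) (int w)"
  have K: "glued_subgroup x w = {f i j |i j. (i, j) \<in> L}"
    by (simp add: L_def x glued_subgroup_def)
  have L: "(i - i', j - j') \<in> L" if "(i, j) \<in> L" "(i', j') \<in> L" for i j i' j'
  proof -
    from that obtain k l k' l' where "i = int p ^ x2 * k" "j = int p ^ x5 * l"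
      "[l = int w * k] (mod int p ^ x3)" "i' = int p ^ x2 * k'" "j' = int p ^ x5 * l'"
      "[l' = int w * k'] (mod int p ^ x3)"
      by (auto simp: L_def glue_lattice_def)
    moreover then have "[l - l' = int w * (k - k')] (mod int p ^ x3)"
      by (auto simp: right_diff_distrib intro: cong_diff)
    ultimately show ?thesis
      unfolding L_def by (intro glue_latticeI[of _ _ "k - k'" _ _ "l - l'"]) (simp_all add: right_diff_distrib)
  qed
  have 0: "(0, 0) \<in> L"
    unfolding L_def glue_lattice_def by (auto intro!: exI[of _ 0])
  show ?thesis
  proof (rule subgroupI)
    show "glued_subgroup x w \<subseteq> carrier G" "glued_subgroup x w \<noteq> {}"
      using 0 by (auto simp: K)
    show inv: "inv g \<in> glued_subgroup x w" if "g \<in> glued_subgroup x w" for g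
      using that L[OF 0] by (force simp: K simp flip: f_minus)
    show "g \<otimes> h \<in> glued_subgroup x w" if "g \<in> glued_subgroup x w" "h \<in> glued_subgroup x w" for g h
    proof -
      from that obtain i j i' j' where *: "g = f i j" "h = f i' j'" "(i, j) \<in> L" "(i', j') \<in> L"
        by (auto simp: K)
      \<comment> \<open>The sum is written as a difference, so that closure of \<open>L\<close>
        under differences also yields products.\<close>
      have "(i - (0 - i'), j - (0 - j')) \<in> L"
        using * L 0 by blast
      then show ?thesis
        using * by (auto simp: K simp flip: f_add)
    qed
  qed
qed

lemma totative_inverse:
  assumes "w \<in> totatives (p ^ x)"
  obtains w' where "[int w * w' = 1] (mod int p ^ x)"
proof -
  have "coprime (int w) (int (p ^ x))"
    using assms unfolding coprime_int_iff by (simp add: in_totatives_iff)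
  then show ?thesis
    using that cong_solve_coprime_int[of "int w" "int p ^ x"] by auto
qed

text \<open>One of \<open>p ^ x2\<close> and \<open>p ^ x5\<close> divides the other. If it is the
  first, \<open>has_type_quotient_aux\<close> applies directly; otherwise it applies to the
  exchanged coordinates, with the inverse \<open>w'\<close> in place of \<open>w\<close>.\<close>

lemma has_type_glued_quotient:
  assumes x: "(x1, x2, x3, x4, x5) \<in> index_tuples a b" and w: "w \<in> totatives (p ^ x3)"
  shows "has_type (G Mod glued_subgroup (x1, x2, x3, x4, x5) w)
    (int p ^ min x2 x5) (int p ^ (x3 + max x2 x5))"
proof -
  note K = subgroup_glued_subgroup[of "(x1, x2, x3, x4, x5)" w]
  interpret swap: presentation G "\<lambda>i j. f j i" "int p ^ b" "int p ^ a"
    by (rule presentation_swap)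
  obtain w' where w': "[int w * w' = 1] (mod int p ^ x3)"
    using w by (rule totative_inverse)
  note mem = f_mem_glued_subgroup_iff[OF x]
  have mem': "f j i \<in> glued_subgroup (x1, x2, x3, x4, x5) w \<longleftrightarrow>
      (i, j) \<in> glue_lattice (int p ^ x5) (int p ^ x3) (int p ^ x2) w'" for i j
    unfolding mem glue_lattice_swap[OF w'] ..
  show ?thesis
  proof (cases "x2 \<le> x5")
    case True
    then show ?thesis
      using has_type_quotient_aux[OF K mem] by (simp add: power_add le_imp_power_dvd)
  next
    case False
    then show ?thesis
      using swap.has_type_quotient_aux[OF K mem']
      by (simp add: power_add le_imp_power_dvd)
  qed
qed

text \<open>The index equations factor the moduli as in \<open>has_type_subgroup_aux\<close>, with
  \<open>p ^ x1\<close> and \<open>p ^ x4\<close> as the cofactors \<open>C\<close> and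
  \<open>D\<close>. The smaller cofactor has to come from the second coordinate, so the coordinates
  are exchanged when \<open>x1 < x4\<close>.\<close>

lemma has_type_glued_subgroup:
  assumes x: "(x1, x2, x3, x4, x5) \<in> index_tuples a b" and w: "w \<in> totatives (p ^ x3)"
  shows "has_type (G\<lparr>carrier := glued_subgroup (x1, x2, x3, x4, x5) w\<rparr>)
    (int p ^ min x1 x4) (int p ^ (x3 + max x1 x4))"
proof -
  note K = subgroup_glued_subgroup[of "(x1, x2, x3, x4, x5)" w]
  interpret swap: presentation G "\<lambda>i j. f j i" "int p ^ b" "int p ^ a"
    by (rule presentation_swap)
  obtain w' where w': "[int w * w' = 1] (mod int p ^ x3)"
    using w by (rule totative_inverse)
  have eq: "glued_subgroup (x1, x2, x3, x4, x5) w =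
      {f i j |i j. (i, j) \<in> glue_lattice (int p ^ x2) (int p ^ x3) (int p ^ x5) (int w)}"
    by (simp add: glued_subgroup_def)
  have eq': "glued_subgroup (x1, x2, x3, x4, x5) w =
      {f j i |i j. (i, j) \<in> glue_lattice (int p ^ x5) (int p ^ x3) (int p ^ x2) w'}"
    unfolding eq glue_lattice_swap[OF w'] by blast
  have ab: "int p ^ a = int p ^ x2 * int p ^ x3 * int p ^ x1"
    "int p ^ b = int p ^ x5 * int p ^ x3 * int p ^ x4"
    using x by (auto simp: index_tuples_def power_add)
  show ?thesis
  proof (cases "x4 \<le> x1")
    case True
    then show ?thesis
      using has_type_subgroup_aux[OF K eq ab]
      by (simp add: power_add le_imp_power_dvd has_type_swap[of _ "int p ^ x4"])
  next
    case False
    then show ?thesis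
      using swap.has_type_subgroup_aux[OF K eq' ab(2,1)]
      by (simp add: power_add le_imp_power_dvd has_type_swap[of _ "int p ^ x1"])
  qed
qed

section \<open>Bijectivity of the parametrisation\<close>

lemma p_power_dvd_iff [simp]: "int p ^ k dvd int p ^ l \<longleftrightarrow> k \<le> l"
proof -
  have "int p ^ k dvd int p ^ l \<longleftrightarrow> p ^ k dvd p ^ l"
    by (simp flip: of_nat_power)
  also have "\<dots> \<longleftrightarrow> k \<le> l"
    using prime_gt_1_nat[OF prime_p] by (simp add: dvd_power_iff_le)
  finally show ?thesis .
qed

text \<open>The inclusion is tested on three elements of the smaller lattice, with coordinates
  \<open>(w', 1)\<close>, \<open>(1, w)\<close> and \<open>(0, p ^ x3)\<close> relative to
  \<open>p ^ x2\<close> and \<open>p ^ x5\<close>. The first two have one coordinate generating a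
  projection, which compares the projections. If these agree, the last two compare \<open>w\<close>
  with \<open>v\<close> and \<open>x3\<close> with \<open>y3\<close>.\<close>

lemma glue_lattice_subset_imp:
  assumes L: "glue_lattice (int p ^ x2) (int p ^ x3) (int p ^ x5) (int w)
      \<subseteq> glue_lattice (int p ^ y2) (int p ^ y3) (int p ^ y5) (int v)"
    and w: "w \<in> totatives (p ^ x3)"
  shows "y2 \<le> x2" "y5 \<le> x5"
    and "x2 = y2 \<Longrightarrow> x5 = y5 \<Longrightarrow> y3 \<le> x3 \<and> [int w = int v] (mod int p ^ y3)"
proof -
  obtain w' where w': "[int w * w' = 1] (mod int p ^ x3)"
    using w by (rule totative_inverse)
  have "(int p ^ x2 * w', int p ^ x5 * 1) \<in> glue_lattice (int p ^ x2) (int p ^ x3) (int p ^ x5) (int w)"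
    using w' by (subst glue_lattice_mult_iff) (auto intro: cong_sym)
  with L have 1: "(int p ^ x2 * w', int p ^ x5 * 1) \<in> glue_lattice (int p ^ y2) (int p ^ y3) (int p ^ y5) (int v)"
    by blast
  have "(int p ^ x2 * 1, int p ^ x5 * int w) \<in> glue_lattice (int p ^ x2) (int p ^ x3) (int p ^ x5) (int w)"
    by (subst glue_lattice_mult_iff) auto
  with L have 2: "(int p ^ x2 * 1, int p ^ x5 * int w) \<in> glue_lattice (int p ^ y2) (int p ^ y3) (int p ^ y5) (int v)"
    by blast
  have "(int p ^ x2 * 0, int p ^ x5 * int p ^ x3) \<in> glue_lattice (int p ^ x2) (int p ^ x3) (int p ^ x5) (int w)"
    by (subst glue_lattice_mult_iff) (auto simp: cong_0_iff)
  with L have 3: "(int p ^ x2 * 0, int p ^ x5 * int p ^ x3) \<in> glue_lattice (int p ^ y2) (int p ^ y3) (int p ^ y5) (int v)"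
    by blast
  have "int p ^ y2 dvd int p ^ x2"
    using 2 by (elim glue_latticeE) simp
  then show "y2 \<le> x2"
    by simp
  have "int p ^ y5 dvd int p ^ x5"
    using 1 by (elim glue_latticeE) simp
  then show "y5 \<le> x5"
    by simp
  assume eq: "x2 = y2" "x5 = y5"
  have "[int w = int v * 1] (mod int p ^ y3)"
    using 2 unfolding eq by (subst (asm) glue_lattice_mult_iff) simp_all
  moreover have "[int p ^ x3 = int v * 0] (mod int p ^ y3)"
    using 3 unfolding eq by (subst (asm) glue_lattice_mult_iff) simp_all
  ultimately show "y3 \<le> x3 \<and> [int w = int v] (mod int p ^ y3)"
    by (simp add: cong_0_iff)
qed

text \<open>The subgroup determines its lattice, as the set of pairs that \<open>f\<close> maps into
  it. Inclusion in both directions then fixes \<open>x2\<close>, \<open>x5\<close>,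
  \<open>x3\<close> and the residue of \<open>w\<close>, and the index equations give
  \<open>x1\<close> and \<open>x4\<close>.\<close>

lemma inj_on_glued_subgroup:
  "inj_on (\<lambda>(x, w). glued_subgroup x w)
     (SIGMA x:index_tuples a b. case x of (x1, x2, x3, x4, x5) \<Rightarrow> totatives (p ^ x3))"
proof (rule inj_onI, clarify)
  fix x1 x2 x3 x4 x5 w y1 y2 y3 y4 y5 v
  assume x: "(x1, x2, x3, x4, x5) \<in> index_tuples a b" and w: "w \<in> totatives (p ^ x3)"
    and y: "(y1, y2, y3, y4, y5) \<in> index_tuples a b" and v: "v \<in> totatives (p ^ y3)"
    and eq: "glued_subgroup (x1, x2, x3, x4, x5) w = glued_subgroup (y1, y2, y3, y4, y5) v"
  have L: "glue_lattice (int p ^ x2) (int p ^ x3) (int p ^ x5) (int w) =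
      glue_lattice (int p ^ y2) (int p ^ y3) (int p ^ y5) (int v)"
    using f_mem_glued_subgroup_iff[OF x, of _ _ w] f_mem_glued_subgroup_iff[OF y, of _ _ v]
    unfolding eq by auto
  have 2: "x2 = y2" and 5: "x5 = y5"
    using glue_lattice_subset_imp(1,2)[OF equalityD1[OF L] w]
      glue_lattice_subset_imp(1,2)[OF equalityD2[OF L] v] by auto
  have 3: "x3 = y3" and cong: "[int w = int v] (mod int p ^ x3)"
    using glue_lattice_subset_imp(3)[OF equalityD1[OF L] w]
      glue_lattice_subset_imp(3)[OF equalityD2[OF L] v] 2 5 by auto
  \<comment> \<open>Totatives of \<open>p ^ x3\<close> lie between 1 and \<open>p ^ x3\<close>, and
    the upper end occurs only for modulus 1, so congruent totatives are equal.\<close>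
  have "w = v"
  proof -
    have "[w = v] (mod p ^ x3)"
      using cong by (simp flip: cong_int_iff)
    then show ?thesis
      using w v unfolding 3 in_totatives_iff by (metis cong_less_modulus_unique_nat cong_def
          le_neq_implies_less mod_less mod_self not_gr_zero)
  qed
  then show "(x1, x2, x3, x4, x5) = (y1, y2, y3, y4, y5) \<and> w = v"
    using 2 3 5 x y by (auto simp: index_tuples_def)
qed

text \<open>The lattice \<open>L\<close> of pairs mapped into \<open>K\<close> contains the kernel
  of \<open>f\<close>, so its projections and its intersection with the second axis are generated by
  powers of \<open>p\<close>. The projections give \<open>x2\<close> and \<open>x5\<close>, the
  intersection gives \<open>x3\<close>, and an element of \<open>L\<close> over the generator
  \<open>p ^ x2\<close> gives \<open>w\<close>.\<close>

lemma subgroup_eq_glued_subgroup: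
  assumes K: "subgroup K G"
  obtains x1 x2 x3 x4 x5 w where "(x1, x2, x3, x4, x5) \<in> index_tuples a b"
    "w \<in> totatives (p ^ x3)" "K = glued_subgroup (x1, x2, x3, x4, x5) w"
proof -
  define L where "L = {(i, j). f i j \<in> K}"
  have L_diff: "(i - i', j - j') \<in> L" if "(i, j) \<in> L" "(i', j') \<in> L" for i j i' j'
    using that subgroup.m_closed[OF K] subgroup.m_inv_closed[OF K]
    by (auto simp: L_def f_diff)
  have L_ker: "(i, j) \<in> L" if "int p ^ a dvd i" "int p ^ b dvd j" for i j
    using that f_one_iff[of i j] subgroup.one_closed[OF K] by (auto simp: L_def)
  have L_mult: "(r * i, r * j) \<in> L" if "(i, j) \<in> L" for r i j
    using that subgroup_int_pow_closed[OF K] by (simp add: L_def f_int_pow)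
  have L_diff_iff: "(i - i', j - j') \<in> L \<longleftrightarrow> (i, j) \<in> L" if "(i', j') \<in> L" for i j i' j'
    using L_diff[of "i - i'" "j - j'" "- i'" "- j'"] L_diff[of i j i' j'] L_mult[of i' j' "-1"] that
    by auto
  have x2_diff: "i - j \<in> fst ` L" if "i \<in> fst ` L" "j \<in> fst ` L" for i j
      using that L_diff by force
  have x2_mem: "int p ^ a \<in> fst ` L"
      using L_ker[of "int p ^ a" 0] by force
  obtain x2 where x2: "x2 \<le> a" "\<And>i. i \<in> fst ` L \<longleftrightarrow> int p ^ x2 dvd i"
    using int_subgroup_containing_prime_power[OF prime_p x2_diff x2_mem] by blast
  have x5_diff: "i - j \<in> snd ` L" if "i \<in> snd ` L" "j \<in> snd ` L" for i j
      using that L_diff by force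
  have x5_mem: "int p ^ b \<in> snd ` L"
      using L_ker[of 0 "int p ^ b"] by force
  obtain x5 where x5: "x5 \<le> b" "\<And>j. j \<in> snd ` L \<longleftrightarrow> int p ^ x5 dvd j"
    using int_subgroup_containing_prime_power[OF prime_p x5_diff x5_mem] by blast
  have e_diff: "i - j \<in> {j. (0, j) \<in> L}" if "i \<in> {j. (0, j) \<in> L}" "j \<in> {j. (0, j) \<in> L}" for i j
      using that L_diff[of 0 i 0 j] by simp
  have e_mem: "int p ^ b \<in> {j. (0, j) \<in> L}"
      using L_ker[of 0 "int p ^ b"] by simp
  obtain e where e: "e \<le> b" "\<And>j. j \<in> {j. (0, j) \<in> L} \<longleftrightarrow> int p ^ e dvd j"
    using int_subgroup_containing_prime_power[OF prime_p e_diff e_mem] by blast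
  have "int p ^ e \<in> snd ` L"
    using e(2)[of "int p ^ e"] by force
  then have "x5 \<le> e"
    using x5(2) by simp
  \<comment> \<open>The second-axis part of \<open>L\<close> is generated by \<open>p ^ e\<close>
    and lies in the second projection, generated by \<open>p ^ x5\<close>; the quotient of the two
    is cyclic of order \<open>p ^ x3\<close>.\<close>
  define x3 where "x3 = e - x5"
  have e_eq: "e = x5 + x3"
    using \<open>x5 \<le> e\<close> by (simp add: x3_def)
  obtain w0 where w0: "(int p ^ x2, int p ^ x5 * w0) \<in> L"
  proof -
    have "int p ^ x2 \<in> fst ` L"
      by (simp add: x2(2))
    then obtain j where j: "(int p ^ x2, j) \<in> L"
      by force
    then have "j \<in> snd ` L"
      by force
    with j that show ?thesis
      by (auto simp: x5(2))
  qed
  \<comment> \<open>Subtracting \<open>k\<close> times the chosen element of \<open>L\<close> moves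
    the pair onto the second axis, where divisibility by \<open>p ^ e\<close> decides
    membership.\<close>
  have mem0: "(int p ^ x2 * k, int p ^ x5 * l) \<in> L \<longleftrightarrow> [l = w0 * k] (mod int p ^ x3)" for k l
  proof -
    have "(int p ^ x2 * k, int p ^ x5 * l) \<in> L \<longleftrightarrow>
        (int p ^ x2 * k - k * int p ^ x2, int p ^ x5 * l - k * (int p ^ x5 * w0)) \<in> L"
      by (rule L_diff_iff[OF L_mult[OF w0], symmetric])
    also have "\<dots> \<longleftrightarrow> int p ^ e dvd int p ^ x5 * (l - w0 * k)"
      using e(2)[of "int p ^ x5 * (l - w0 * k)"] by (simp add: algebra_simps)
    also have "\<dots> \<longleftrightarrow> [l = w0 * k] (mod int p ^ x3)"
      by (simp add: e_eq power_add cong_iff_dvd_diff)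
    finally show ?thesis .
  qed
  \<comment> \<open>An element of \<open>L\<close> over the generator \<open>p ^ x5\<close> of the
    second projection exhibits an inverse of \<open>w0\<close>.\<close>
  have cop: "coprime w0 (int p ^ x3)"
  proof -
    have "int p ^ x5 \<in> snd ` L"
      by (simp add: x5(2))
    then obtain i where i: "(i, int p ^ x5) \<in> L"
      by force
    then have "i \<in> fst ` L"
      by force
    then obtain k where "i = int p ^ x2 * k"
      by (auto simp: x2(2))
    with i have "[1 = w0 * k] (mod int p ^ x3)"
      using mem0[of k 1] by simp
    then show ?thesis
      using coprime_iff_invertible_int cong_sym by blast
  qed
  \<comment> \<open>The residue of \<open>w0\<close> is the representative, except for
    \<open>x3 = 0\<close>: there the residue is 0, but the only totative of 1 is 1.\<close>
  obtain w where w: "w \<in> totatives (p ^ x3)" "[int w = w0] (mod int p ^ x3)"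
  proof (cases "x3 = 0")
    case True
    then show ?thesis
      using that[of 1] by simp
  next
    case False
    define w where "w = nat (w0 mod int p ^ x3)"
    have "int p ^ x3 > 0"
      by simp
    then have w: "int w = w0 mod int p ^ x3" "int w < int (p ^ x3)"
      by (simp_all add: w_def)
    have "coprime (w0 mod int p ^ x3) (int p ^ x3)"
      using cop by (subst coprime_mod_left_iff) simp_all
    then have "coprime (int w) (int (p ^ x3))"
      by (simp only: w(1) of_nat_power)
    then have "coprime w (p ^ x3)"
      by (simp only: coprime_int_iff)
    moreover have "w \<noteq> 0"
      using \<open>coprime w (p ^ x3)\<close> False prime_gt_1_nat[OF prime_p] by (auto intro!: Nat.gr0I)
    ultimately have "w \<in> totatives (p ^ x3)"
      using w(2) by (simp add: in_totatives_iff)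
    moreover have "[int w = w0] (mod int p ^ x3)"
      by (simp add: w(1) cong_def)
    ultimately show ?thesis
      by (rule that)
  qed
  have mem: "(i, j) \<in> L \<longleftrightarrow> (i, j) \<in> glue_lattice (int p ^ x2) (int p ^ x3) (int p ^ x5) (int w)" for i j
  proof
    assume ij: "(i, j) \<in> L"
    then have "i \<in> fst ` L" "j \<in> snd ` L"
      by force+
    then obtain k l where kl: "i = int p ^ x2 * k" "j = int p ^ x5 * l"
      unfolding x2(2) x5(2) by (elim dvdE)
    moreover have "[l = int w * k] (mod int p ^ x3)"
      using ij mem0[of k l] kl w(2) by (metis cong_scalar_right cong_sym cong_trans)
    ultimately show "(i, j) \<in> glue_lattice (int p ^ x2) (int p ^ x3) (int p ^ x5) (int w)"
      by (rule glue_latticeI)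
  next
    assume "(i, j) \<in> glue_lattice (int p ^ x2) (int p ^ x3) (int p ^ x5) (int w)"
    then obtain k l where "i = int p ^ x2 * k" "j = int p ^ x5 * l" "[l = int w * k] (mod int p ^ x3)"
      by (rule glue_latticeE)
    then show "(i, j) \<in> L"
      using mem0[of k l] w(2) by (metis cong_scalar_right cong_sym cong_trans)
  qed
  \<comment> \<open>This makes \<open>a - x2 - x3\<close> a genuine difference of natural numbers.
    It comes from the kernel element \<open>(p ^ a, 0)\<close> and the invertibility of
    \<open>w0\<close>.\<close>
  have "x3 \<le> a - x2"
  proof -
    have "(int p ^ x2 * int p ^ (a - x2), int p ^ x5 * 0) \<in> L"
      using L_ker[of "int p ^ a" 0] x2(1) by (simp flip: power_add)
    then have "[0 = w0 * int p ^ (a - x2)] (mod int p ^ x3)"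
      by (simp only: mem0)
    then have "int p ^ x3 dvd w0 * int p ^ (a - x2)"
      by (simp add: cong_0_iff cong_sym_eq[of 0])
    then have "int p ^ x3 dvd int p ^ (a - x2)"
      using cop by (simp add: coprime_dvd_mult_right_iff coprime_commute)
    then show ?thesis
      by simp
  qed
  then have idx: "(a - x2 - x3, x2, x3, b - e, x5) \<in> index_tuples a b"
    using x2(1) e(1) e_eq by (auto simp: index_tuples_def)
  have "K = {f i j |i j. (i, j) \<in> L}"
    using f_surj[OF subgroup.mem_carrier[OF K]] by (auto simp: L_def) blast
  then have "K = glued_subgroup (a - x2 - x3, x2, x3, b - e, x5) w"
    by (simp add: glued_subgroup_def mem)
  with idx w(1) that show ?thesis
    by blast
qed

lemma bij_betw_glued_subgroup:
  "bij_betw (\<lambda>(x, w). glued_subgroup x w)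
     (SIGMA x:index_tuples a b. case x of (x1, x2, x3, x4, x5) \<Rightarrow> totatives (p ^ x3))
     {K. subgroup K G}"
  unfolding bij_betw_def
proof (intro conjI inj_on_glued_subgroup equalityI subsetI)
  fix K
  assume "K \<in> {K. subgroup K G}"
  then obtain x1 x2 x3 x4 x5 w where "(x1, x2, x3, x4, x5) \<in> index_tuples a b"
    "w \<in> totatives (p ^ x3)" "K = glued_subgroup (x1, x2, x3, x4, x5) w"
    using subgroup_eq_glued_subgroup by blast
  then show "K \<in> (\<lambda>(x, w). glued_subgroup x w) `
      (SIGMA x:index_tuples a b. case x of (x1, x2, x3, x4, x5) \<Rightarrow> totatives (p ^ x3))"
    by (intro image_eqI[of _ _ "((x1, x2, x3, x4, x5), w)"]) auto
qed (auto simp: subgroup_glued_subgroup)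

end

section \<open>Goursat's lemma\<close>

text \<open>
  As with \<open>auto\<close>, extensionality ensures that each isomorphism is counted once.
\<close>

definition group_isos :: "('a, 'c) monoid_scheme \<Rightarrow> ('b, 'd) monoid_scheme \<Rightarrow> ('a \<Rightarrow> 'b) set" where
  "group_isos A B = iso A B \<inter> extensional (carrier A)"

lemma finite_group_isos:
  assumes "finite (carrier A)" "finite (carrier B)"
  shows "finite (group_isos A B)"
proof (rule finite_subset)
  show "group_isos A B \<subseteq> carrier A \<rightarrow>\<^sub>E carrier B"
    by (auto simp: group_isos_def iso_def hom_def PiE_def)
qed (use assms in \<open>auto intro: finite_PiE\<close>)

lemma finite_subgroups:
  assumes "finite (carrier G)"
  shows "finite {K. subgroup K G}"
  using assms by (rule finite_subset[OF _ finite_Pow_iff[THEN iffD2], rotated])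
    (auto dest: subgroup.subset)

section \<open>Coset arithmetic in a subquotient\<close>

context comm_group
begin

context
  fixes K1 K2
  assumes K1: "subgroup K1 G" and K2: "subgroup K2 (G\<lparr>carrier := K1\<rparr>)"
begin

lemma subquotient_subgroup: "subgroup K2 G"
  using K1 K2 by (rule incl_subgroup)

lemma subquotient_subset: "K2 \<subseteq> K1"
  using subgroup.subset[OF K2] by simp

lemma subquotient_carrier: "carrier (G\<lparr>carrier := K1\<rparr> Mod K2) = (\<lambda>g. K2 #> g) ` K1"
  by (simp add: carrier_FactGroup)

lemma subquotient_mult:
  assumes "g \<in> K1" "h \<in> K1"
  shows "(K2 #> g) \<otimes>\<^bsub>G\<lparr>carrier := K1\<rparr> Mod K2\<^esub> (K2 #> h) = K2 #> (g \<otimes> h)"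
  using normal.rcos_sum[OF subgroup_imp_normal[OF subquotient_subgroup]]
    assms subgroup.subset[OF K1] by (auto simp: subset_eq)

lemma subquotient_group: "group (G\<lparr>carrier := K1\<rparr> Mod K2)"
  using comm_group.abelian_FactGroup[OF subgroup_imp_comm_group[OF K1] K2]
  by (rule comm_group.axioms)

lemma subquotient_inv:
  assumes "g \<in> K1"
  shows "inv\<^bsub>G\<lparr>carrier := K1\<rparr> Mod K2\<^esub> (K2 #> g) = K2 #> inv g"
proof (rule group.inv_equality[OF subquotient_group])
  have inv: "inv g \<in> K1"
    using K1 assms by (rule subgroup.m_inv_closed)
  have g: "g \<in> carrier G"
    using subgroup.mem_carrier[OF K1 assms] .
  show "(K2 #> inv g) \<otimes>\<^bsub>G\<lparr>carrier := K1\<rparr> Mod K2\<^esub> (K2 #> g) = \<one>\<^bsub>G\<lparr>carrier := K1\<rparr> Mod K2\<^esub>"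
    unfolding subquotient_mult[OF inv assms]
    using g subgroup.subset[OF subquotient_subgroup] by simp
  show "K2 #> g \<in> carrier (G\<lparr>carrier := K1\<rparr> Mod K2)"
    "K2 #> inv g \<in> carrier (G\<lparr>carrier := K1\<rparr> Mod K2)"
    using assms inv by (auto simp: subquotient_carrier)
qed

lemma subquotient_eq_iff:
  assumes "g \<in> K1" "h \<in> K1"
  shows "K2 #> g = K2 #> h \<longleftrightarrow> g \<in> K2 #> h"
  using assms subgroup.mem_carrier[OF K1] repr_independence[OF _ _ subquotient_subgroup]
    rcos_self[OF _ subquotient_subgroup] by metis

lemma subquotient_eq_one_iff:
  assumes "g \<in> K1"
  shows "K2 #> g = K2 \<longleftrightarrow> g \<in> K2"
  using assms subgroup.mem_carrier[OF K1] coset_join1[OF _ _ subquotient_subgroup]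
    coset_join2[OF _ subquotient_subgroup] by metis

end

end

text \<open>This is the fibre product of \<open>K1\<close> and \<open>L1\<close> over the common
  quotient, that is, the preimage of the graph of \<open>\<theta>\<close> under the two quotient
  maps.\<close>

definition glue_graph where
  "glue_graph G H = (\<lambda>(K1, K2, L1, L2, \<theta>).
     {(g, h). g \<in> K1 \<and> h \<in> L1 \<and> \<theta> (K2 #>\<^bsub>G\<^esub> g) = L2 #>\<^bsub>H\<^esub> h})"

text \<open>The nested dependent sums turn the cardinality into an iterated sum over the two chains.
  In the commutative setting below, every \<open>K2\<close> is normal in \<open>K1\<close>.\<close>

definition goursat_data where
  "goursat_data G H = (SIGMA K1:{K. subgroup K G}. SIGMA K2:{K. subgroup K (G\<lparr>carrier := K1\<rparr>)}.
     SIGMA L1:{L. subgroup L H}. SIGMA L2:{L. subgroup L (H\<lparr>carrier := L1\<rparr>)}.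
     group_isos (G\<lparr>carrier := K1\<rparr> Mod K2) (H\<lparr>carrier := L1\<rparr> Mod L2))"

text \<open>This is the inverse of \<open>glue_graph\<close>. The isomorphism sends a coset to the
  set of all partners of its elements, which avoids choosing representatives;
  \<open>glue_map_coset\<close> shows that this set is again a coset.\<close>

definition glue_data where
  "glue_data G H S = (fst ` S, {g. (g, \<one>\<^bsub>H\<^esub>) \<in> S}, snd ` S, {h. (\<one>\<^bsub>G\<^esub>, h) \<in> S},
     \<lambda>C\<in>carrier (G\<lparr>carrier := fst ` S\<rparr> Mod {g. (g, \<one>\<^bsub>H\<^esub>) \<in> S}). {h. \<exists>g\<in>C. (g, h) \<in> S})"

locale comm_group_pair = G: comm_group G + H: comm_group H
  for G :: "('a, 'c) monoid_scheme" and H :: "('b, 'd) monoid_scheme"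
begin

section \<open>From Goursat data to a subgroup of the product\<close>

context
  fixes K1 K2 L1 L2 \<theta>
  assumes data: "(K1, K2, L1, L2, \<theta>) \<in> goursat_data G H"
begin

abbreviation (input) "QG \<equiv> G\<lparr>carrier := K1\<rparr> Mod K2"
abbreviation (input) "QH \<equiv> H\<lparr>carrier := L1\<rparr> Mod L2"

lemma data': "subgroup K1 G" "subgroup K2 (G\<lparr>carrier := K1\<rparr>)" "subgroup L1 H"
  "subgroup L2 (H\<lparr>carrier := L1\<rparr>)" "\<theta> \<in> iso QG QH" "\<theta> \<in> extensional (carrier QG)"
  using data by (auto simp: goursat_data_def group_isos_def)

lemmas KQ = data'(1,2) and LQ = data'(3,4)

lemma theta_hom: "group_hom QG QH \<theta>"
  using data'(5) G.subquotient_group[OF KQ] H.subquotient_group[OF LQ]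
  by (simp add: group_hom_def group_hom_axioms_def iso_def)

lemma theta_mult:
  assumes "g \<in> K1" "g' \<in> K1"
  shows "\<theta> (K2 #>\<^bsub>G\<^esub> (g \<otimes>\<^bsub>G\<^esub> g')) = \<theta> (K2 #>\<^bsub>G\<^esub> g) \<otimes>\<^bsub>QH\<^esub> \<theta> (K2 #>\<^bsub>G\<^esub> g')"
proof -
  interpret group_hom QG QH \<theta> by (rule theta_hom)
  show ?thesis
    using assms hom_mult[of "K2 #>\<^bsub>G\<^esub> g" "K2 #>\<^bsub>G\<^esub> g'"]
    unfolding G.subquotient_mult[OF KQ assms] G.subquotient_carrier[OF KQ] by blast
qed

lemma theta_one: "\<theta> K2 = L2"
proof -
  interpret group_hom QG QH \<theta> by (rule theta_hom)
  show ?thesis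
    using hom_one by simp
qed

lemma theta_inv:
  assumes "g \<in> K1"
  shows "\<theta> (K2 #>\<^bsub>G\<^esub> inv\<^bsub>G\<^esub> g) = inv\<^bsub>QH\<^esub> \<theta> (K2 #>\<^bsub>G\<^esub> g)"
proof -
  interpret group_hom QG QH \<theta> by (rule theta_hom)
  show ?thesis
    using assms hom_inv[of "K2 #>\<^bsub>G\<^esub> g"]
    unfolding G.subquotient_inv[OF KQ assms] G.subquotient_carrier[OF KQ] by blast
qed

lemma theta_bij: "bij_betw \<theta> ((\<lambda>g. K2 #>\<^bsub>G\<^esub> g) ` K1) ((\<lambda>h. L2 #>\<^bsub>H\<^esub> h) ` L1)"
  using data'(5) by (simp add: iso_def G.subquotient_carrier[OF KQ] H.subquotient_carrier[OF LQ])

lemma subgroup_glue_graph: "subgroup (glue_graph G H (K1, K2, L1, L2, \<theta>)) (G \<times>\<times> H)"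
proof (rule group.subgroupI)
  let ?S = "glue_graph G H (K1, K2, L1, L2, \<theta>)"
  show "group (G \<times>\<times> H)"
    by (intro DirProd_group G.is_group H.is_group)
  show "?S \<subseteq> carrier (G \<times>\<times> H)"
    using subgroup.mem_carrier[OF KQ(1)] subgroup.mem_carrier[OF LQ(1)]
    by (auto simp: glue_graph_def)
  have "K2 #>\<^bsub>G\<^esub> \<one>\<^bsub>G\<^esub> = K2" "L2 #>\<^bsub>H\<^esub> \<one>\<^bsub>H\<^esub> = L2"
    using subgroup.subset[OF G.subquotient_subgroup[OF KQ]]
      subgroup.subset[OF H.subquotient_subgroup[OF LQ]] by simp_all
  then have "(\<one>\<^bsub>G\<^esub>, \<one>\<^bsub>H\<^esub>) \<in> ?S"
    using subgroup.one_closed[OF KQ(1)] subgroup.one_closed[OF LQ(1)]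
    by (simp add: glue_graph_def theta_one)
  then show "?S \<noteq> {}" by blast
  show "inv\<^bsub>G \<times>\<times> H\<^esub> s \<in> ?S" if "s \<in> ?S" for s
    using that subgroup.m_inv_closed[OF KQ(1)] subgroup.m_inv_closed[OF LQ(1)]
      subgroup.mem_carrier[OF KQ(1)] subgroup.mem_carrier[OF LQ(1)]
    by (auto simp: glue_graph_def theta_inv H.subquotient_inv[OF LQ] G.is_group H.is_group)
  show "s \<otimes>\<^bsub>G \<times>\<times> H\<^esub> t \<in> ?S" if "s \<in> ?S" "t \<in> ?S" for s t
    using that subgroup.m_closed[OF KQ(1)] subgroup.m_closed[OF LQ(1)]
    by (auto simp: glue_graph_def theta_mult simp flip: H.subquotient_mult[OF LQ])
qed

text \<open>Every coset has an image and, by surjectivity of \<open>\<theta>\<close>, a preimage, so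
  the projections are \<open>K1\<close> and \<open>L1\<close>. Injectivity recovers
  \<open>K2\<close> from the elements with trivial partner, and \<open>\<theta> K2 = L2\<close>
  recovers \<open>L2\<close>.\<close>

lemma glue_data_glue_graph: "glue_data G H (glue_graph G H (K1, K2, L1, L2, \<theta>)) = (K1, K2, L1, L2, \<theta>)"
proof -
  define S where "S = glue_graph G H (K1, K2, L1, L2, \<theta>)"
  have S: "(g, h) \<in> S \<longleftrightarrow> g \<in> K1 \<and> h \<in> L1 \<and> \<theta> (K2 #>\<^bsub>G\<^esub> g) = L2 #>\<^bsub>H\<^esub> h" for g h
    by (simp add: S_def glue_graph_def)
  have ex1: "\<exists>h\<in>L1. \<theta> (K2 #>\<^bsub>G\<^esub> g) = L2 #>\<^bsub>H\<^esub> h" if "g \<in> K1" for g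
    using bij_betw_apply[OF theta_bij imageI[OF that]] by (simp add: image_iff)
  have ex2: "\<exists>g\<in>K1. \<theta> (K2 #>\<^bsub>G\<^esub> g) = L2 #>\<^bsub>H\<^esub> h" if "h \<in> L1" for h
  proof -
    have "L2 #>\<^bsub>H\<^esub> h \<in> \<theta> ` (\<lambda>g. K2 #>\<^bsub>G\<^esub> g) ` K1"
      unfolding bij_betw_imp_surj_on[OF theta_bij] using that by (rule imageI)
    then show ?thesis
      by auto
  qed
  have 1: "fst ` S = K1"
  proof (intro equalityI subsetI)
    fix g
    assume "g \<in> K1"
    moreover then obtain h where "h \<in> L1" "\<theta> (K2 #>\<^bsub>G\<^esub> g) = L2 #>\<^bsub>H\<^esub> h"
      using ex1 by blast
    ultimately show "g \<in> fst ` S"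
      by (intro image_eqI[of _ _ "(g, h)"]) (simp_all add: S)
  qed (auto simp: S)
  have 3: "snd ` S = L1"
  proof (intro equalityI subsetI)
    fix h
    assume "h \<in> L1"
    moreover then obtain g where "g \<in> K1" "\<theta> (K2 #>\<^bsub>G\<^esub> g) = L2 #>\<^bsub>H\<^esub> h"
      using ex2 by blast
    ultimately show "h \<in> snd ` S"
      by (intro image_eqI[of _ _ "(g, h)"]) (simp_all add: S)
  qed (auto simp: S)
  have K2: "K2 #>\<^bsub>G\<^esub> \<one>\<^bsub>G\<^esub> = K2" "L2 #>\<^bsub>H\<^esub> \<one>\<^bsub>H\<^esub> = L2"
    using subgroup.subset[OF G.subquotient_subgroup[OF KQ]]
      subgroup.subset[OF H.subquotient_subgroup[OF LQ]] by simp_all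
  have K2_mem: "K2 \<in> (\<lambda>g. K2 #>\<^bsub>G\<^esub> g) ` K1"
    using K2(1) subgroup.one_closed[OF KQ(1)] by force
  have "(g, \<one>\<^bsub>H\<^esub>) \<in> S \<longleftrightarrow> g \<in> K2" for g
  proof -
    have "(g, \<one>\<^bsub>H\<^esub>) \<in> S \<longleftrightarrow> g \<in> K1 \<and> \<theta> (K2 #>\<^bsub>G\<^esub> g) = \<theta> K2"
      by (simp add: S K2 subgroup.one_closed[OF LQ(1)] theta_one)
    also have "\<dots> \<longleftrightarrow> g \<in> K1 \<and> K2 #>\<^bsub>G\<^esub> g = K2"
      using inj_on_eq_iff[OF bij_betw_imp_inj_on[OF theta_bij] _ K2_mem] by auto
    also have "\<dots> \<longleftrightarrow> g \<in> K2"
      using G.subquotient_subset[OF KQ] G.subquotient_eq_one_iff[OF KQ] by blast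
    finally show ?thesis .
  qed
  then have 2: "{g. (g, \<one>\<^bsub>H\<^esub>) \<in> S} = K2"
    by simp
  have "(\<one>\<^bsub>G\<^esub>, h) \<in> S \<longleftrightarrow> h \<in> L2" for h
  proof -
    have "(\<one>\<^bsub>G\<^esub>, h) \<in> S \<longleftrightarrow> h \<in> L1 \<and> L2 #>\<^bsub>H\<^esub> h = L2"
      by (auto simp: S K2 subgroup.one_closed[OF KQ(1)] theta_one)
    then show ?thesis
      using H.subquotient_subset[OF LQ] H.subquotient_eq_one_iff[OF LQ] by blast
  qed
  then have 4: "{h. (\<one>\<^bsub>G\<^esub>, h) \<in> S} = L2"
    by simp
  have "(\<lambda>C\<in>carrier QG. {h. \<exists>g\<in>C. (g, h) \<in> S}) = \<theta>"
  proof (rule extensionalityI[OF restrict_extensional data'(6)])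
    fix C
    assume C: "C \<in> carrier QG"
    then obtain g where g: "g \<in> K1" "C = K2 #>\<^bsub>G\<^esub> g"
      by (auto simp: G.subquotient_carrier[OF KQ])
    obtain h where h: "h \<in> L1" "\<theta> C = L2 #>\<^bsub>H\<^esub> h"
      using ex1 g by blast
    have C_sub: "g' \<in> K1 \<and> K2 #>\<^bsub>G\<^esub> g' = C" if "g' \<in> C" for g'
    proof -
      have "g' \<in> K1"
        using that g subgroup.m_closed[OF KQ(1)] G.subquotient_subset[OF KQ]
        by (auto simp: r_coset_def)
      with that show ?thesis
        using g G.subquotient_eq_iff[OF KQ] by blast
    qed
    have "g \<in> C"
      using g G.rcos_self[OF _ G.subquotient_subgroup[OF KQ]] subgroup.mem_carrier[OF KQ(1)] by blast
    \<comment> \<open>All elements of \<open>C\<close> represent the same coset and hence have the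
      same partners, which are exactly the elements of the coset \<open>\<theta> C\<close>.\<close>
    have "{h. \<exists>g\<in>C. (g, h) \<in> S} = {h' \<in> L1. L2 #>\<^bsub>H\<^esub> h' = \<theta> C}"
      using C_sub \<open>g \<in> C\<close> by (auto simp: S)
    also have "\<dots> = {h' \<in> L1. h' \<in> L2 #>\<^bsub>H\<^esub> h}"
      using h H.subquotient_eq_iff[OF LQ] by auto
    also have "\<dots> = L2 #>\<^bsub>H\<^esub> h"
      using h subgroup.m_closed[OF LQ(1)] H.subquotient_subset[OF LQ] by (auto simp: r_coset_def)
    finally show "(\<lambda>C\<in>carrier QG. {h. \<exists>g\<in>C. (g, h) \<in> S}) C = \<theta> C"
      using C h by simp
  qed
  then show ?thesis
    by (simp add: glue_data_def 1 2 3 4 flip: S_def)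
qed

end

section \<open>From a subgroup of the product to Goursat data\<close>

context
  fixes S
  assumes S: "subgroup S (G \<times>\<times> H)"
begin

lemma S_carrier: "(g, h) \<in> S \<Longrightarrow> g \<in> carrier G \<and> h \<in> carrier H"
  using subgroup.subset[OF S] by auto

lemma S_one: "(\<one>\<^bsub>G\<^esub>, \<one>\<^bsub>H\<^esub>) \<in> S"
  using subgroup.one_closed[OF S] by simp

lemma S_mult: "(g, h) \<in> S \<Longrightarrow> (g', h') \<in> S \<Longrightarrow> (g \<otimes>\<^bsub>G\<^esub> g', h \<otimes>\<^bsub>H\<^esub> h') \<in> S"
  using subgroup.m_closed[OF S, of "(g, h)" "(g', h')"] by simp

lemma S_inv: "(g, h) \<in> S \<Longrightarrow> (inv\<^bsub>G\<^esub> g, inv\<^bsub>H\<^esub> h) \<in> S"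
  using subgroup.m_inv_closed[OF S, of "(g, h)"] S_carrier[of g h] by (simp add: G.is_group H.is_group)

lemma S_mult_inv: "(g, h) \<in> S \<Longrightarrow> (g', h') \<in> S \<Longrightarrow> (g \<otimes>\<^bsub>G\<^esub> inv\<^bsub>G\<^esub> g', h \<otimes>\<^bsub>H\<^esub> inv\<^bsub>H\<^esub> h') \<in> S"
  by (intro S_mult S_inv)

lemma S_subgroups:
  "subgroup (fst ` S) G" "subgroup (snd ` S) H"
  "subgroup {g. (g, \<one>\<^bsub>H\<^esub>) \<in> S} G" "subgroup {h. (\<one>\<^bsub>G\<^esub>, h) \<in> S} H"
proof -
  have fst_iff: "fst ` S = {g. \<exists>h. (g, h) \<in> S}" and snd_iff: "snd ` S = {h. \<exists>g. (g, h) \<in> S}"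
    by force+
  show "subgroup (fst ` S) G"
    unfolding fst_iff
  proof (rule G.subgroupI)
    show "{g. \<exists>h. (g, h) \<in> S} \<subseteq> carrier G" "{g. \<exists>h. (g, h) \<in> S} \<noteq> {}"
      using S_carrier S_one by blast+
  qed (use S_inv S_mult in blast)+
  show "subgroup (snd ` S) H"
    unfolding snd_iff
  proof (rule H.subgroupI)
    show "{h. \<exists>g. (g, h) \<in> S} \<subseteq> carrier H" "{h. \<exists>g. (g, h) \<in> S} \<noteq> {}"
      using S_carrier S_one by blast+
  qed (use S_inv S_mult in blast)+
  show "subgroup {g. (g, \<one>\<^bsub>H\<^esub>) \<in> S} G"
  proof (rule G.subgroupI)
    show "{g. (g, \<one>\<^bsub>H\<^esub>) \<in> S} \<subseteq> carrier G" "{g. (g, \<one>\<^bsub>H\<^esub>) \<in> S} \<noteq> {}"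
      using S_carrier S_one by blast+
    show "inv\<^bsub>G\<^esub> g \<in> {g. (g, \<one>\<^bsub>H\<^esub>) \<in> S}" if "g \<in> {g. (g, \<one>\<^bsub>H\<^esub>) \<in> S}" for g
      using that S_inv[of g "\<one>\<^bsub>H\<^esub>"] by simp
    show "g \<otimes>\<^bsub>G\<^esub> g' \<in> {g. (g, \<one>\<^bsub>H\<^esub>) \<in> S}"
      if "g \<in> {g. (g, \<one>\<^bsub>H\<^esub>) \<in> S}" "g' \<in> {g. (g, \<one>\<^bsub>H\<^esub>) \<in> S}" for g g'
      using that S_mult[of g "\<one>\<^bsub>H\<^esub>" g' "\<one>\<^bsub>H\<^esub>"] by simp
  qed
  show "subgroup {h. (\<one>\<^bsub>G\<^esub>, h) \<in> S} H"
  proof (rule H.subgroupI)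
    show "{h. (\<one>\<^bsub>G\<^esub>, h) \<in> S} \<subseteq> carrier H" "{h. (\<one>\<^bsub>G\<^esub>, h) \<in> S} \<noteq> {}"
      using S_carrier S_one by blast+
    show "inv\<^bsub>H\<^esub> h \<in> {h. (\<one>\<^bsub>G\<^esub>, h) \<in> S}" if "h \<in> {h. (\<one>\<^bsub>G\<^esub>, h) \<in> S}" for h
      using that S_inv[of "\<one>\<^bsub>G\<^esub>" h] by simp
    show "h \<otimes>\<^bsub>H\<^esub> h' \<in> {h. (\<one>\<^bsub>G\<^esub>, h) \<in> S}"
      if "h \<in> {h. (\<one>\<^bsub>G\<^esub>, h) \<in> S}" "h' \<in> {h. (\<one>\<^bsub>G\<^esub>, h) \<in> S}" for h h'
      using that S_mult[of "\<one>\<^bsub>G\<^esub>" h "\<one>\<^bsub>G\<^esub>" h'] by simp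
  qed
qed

lemma S_subgroups':
  "subgroup {g. (g, \<one>\<^bsub>H\<^esub>) \<in> S} (G\<lparr>carrier := fst ` S\<rparr>)"
  "subgroup {h. (\<one>\<^bsub>G\<^esub>, h) \<in> S} (H\<lparr>carrier := snd ` S\<rparr>)"
  by (intro G.subgroup_incl H.subgroup_incl S_subgroups; force)+

text \<open>The quotient of two elements of \<open>S\<close> with equal second component has trivial
  second component. Hence elements of the first projection lie in one coset exactly when they share
  a partner.\<close>

lemma S_coset_G_iff:
  assumes "(g, h) \<in> S" "(g', h') \<in> S"
  shows "g \<in> {g. (g, \<one>\<^bsub>H\<^esub>) \<in> S} #>\<^bsub>G\<^esub> g' \<longleftrightarrow> (g, h') \<in> S"
proof
  assume "g \<in> {g. (g, \<one>\<^bsub>H\<^esub>) \<in> S} #>\<^bsub>G\<^esub> g'"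
  then obtain k where "(k, \<one>\<^bsub>H\<^esub>) \<in> S" "g = k \<otimes>\<^bsub>G\<^esub> g'"
    by (auto simp: r_coset_def)
  then show "(g, h') \<in> S"
    using S_mult[of k "\<one>\<^bsub>H\<^esub>" g' h'] assms S_carrier[of g' h'] by simp
next
  assume *: "(g, h') \<in> S"
  have "(g \<otimes>\<^bsub>G\<^esub> inv\<^bsub>G\<^esub> g', \<one>\<^bsub>H\<^esub>) \<in> S"
    using S_mult_inv[OF * assms(2)] S_carrier[OF *] by simp
  moreover have "g = (g \<otimes>\<^bsub>G\<^esub> inv\<^bsub>G\<^esub> g') \<otimes>\<^bsub>G\<^esub> g'"
    using S_carrier assms by (simp add: G.m_assoc)
  ultimately show "g \<in> {g. (g, \<one>\<^bsub>H\<^esub>) \<in> S} #>\<^bsub>G\<^esub> g'"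
    unfolding r_coset_def by blast
qed

lemma S_coset_H_iff:
  assumes "(g, h) \<in> S"
  shows "h' \<in> {h. (\<one>\<^bsub>G\<^esub>, h) \<in> S} #>\<^bsub>H\<^esub> h \<longleftrightarrow> (g, h') \<in> S"
proof
  assume "h' \<in> {h. (\<one>\<^bsub>G\<^esub>, h) \<in> S} #>\<^bsub>H\<^esub> h"
  then obtain k where "(\<one>\<^bsub>G\<^esub>, k) \<in> S" "h' = k \<otimes>\<^bsub>H\<^esub> h"
    by (auto simp: r_coset_def)
  then show "(g, h') \<in> S"
    using S_mult[of "\<one>\<^bsub>G\<^esub>" k g h] assms S_carrier[of g h] by simp
next
  assume *: "(g, h') \<in> S"
  have "(\<one>\<^bsub>G\<^esub>, h' \<otimes>\<^bsub>H\<^esub> inv\<^bsub>H\<^esub> h) \<in> S"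
    using S_mult_inv[OF * assms] S_carrier[OF *] by simp
  moreover have "h' = (h' \<otimes>\<^bsub>H\<^esub> inv\<^bsub>H\<^esub> h) \<otimes>\<^bsub>H\<^esub> h"
    using S_carrier[OF *] S_carrier[OF assms] by (simp add: H.m_assoc)
  ultimately show "h' \<in> {h. (\<one>\<^bsub>G\<^esub>, h) \<in> S} #>\<^bsub>H\<^esub> h"
    unfolding r_coset_def by blast
qed

lemma glue_map_coset:
  assumes "(g, h) \<in> S"
  shows "{h'. \<exists>g'\<in>{g. (g, \<one>\<^bsub>H\<^esub>) \<in> S} #>\<^bsub>G\<^esub> g. (g', h') \<in> S} = {h. (\<one>\<^bsub>G\<^esub>, h) \<in> S} #>\<^bsub>H\<^esub> h"
proof (intro equalityI subsetI)
  fix h'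
  assume "h' \<in> {h'. \<exists>g'\<in>{g. (g, \<one>\<^bsub>H\<^esub>) \<in> S} #>\<^bsub>G\<^esub> g. (g', h') \<in> S}"
  then obtain g' where g': "g' \<in> {g. (g, \<one>\<^bsub>H\<^esub>) \<in> S} #>\<^bsub>G\<^esub> g" "(g', h') \<in> S"
    by blast
  then have "(g', h) \<in> S"
    using S_coset_G_iff assms by blast
  then have "h' \<in> {h. (\<one>\<^bsub>G\<^esub>, h) \<in> S} #>\<^bsub>H\<^esub> h"
    using g'(2) S_coset_H_iff by blast
  then show "h' \<in> {h. (\<one>\<^bsub>G\<^esub>, h) \<in> S} #>\<^bsub>H\<^esub> h" .
next
  fix h'
  assume "h' \<in> {h. (\<one>\<^bsub>G\<^esub>, h) \<in> S} #>\<^bsub>H\<^esub> h"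
  then have "(g, h') \<in> S"
    using S_coset_H_iff assms by blast
  moreover have "g \<in> {g. (g, \<one>\<^bsub>H\<^esub>) \<in> S} #>\<^bsub>G\<^esub> g"
    using S_coset_G_iff assms by blast
  ultimately show "h' \<in> {h'. \<exists>g'\<in>{g. (g, \<one>\<^bsub>H\<^esub>) \<in> S} #>\<^bsub>G\<^esub> g. (g', h') \<in> S}"
    by blast
qed

lemma glue_map_iso:
  "(\<lambda>C\<in>carrier (G\<lparr>carrier := fst ` S\<rparr> Mod {g. (g, \<one>\<^bsub>H\<^esub>) \<in> S}). {h. \<exists>g\<in>C. (g, h) \<in> S})
    \<in> group_isos (G\<lparr>carrier := fst ` S\<rparr> Mod {g. (g, \<one>\<^bsub>H\<^esub>) \<in> S})
        (H\<lparr>carrier := snd ` S\<rparr> Mod {h. (\<one>\<^bsub>G\<^esub>, h) \<in> S})"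
proof -
  note KQ = S_subgroups(1) S_subgroups'(1) and LQ = S_subgroups(2) S_subgroups'(2)
  define K2 where "K2 = {g. (g, \<one>\<^bsub>H\<^esub>) \<in> S}"
  define L2 where "L2 = {h. (\<one>\<^bsub>G\<^esub>, h) \<in> S}"
  define Q where "Q = G\<lparr>carrier := fst ` S\<rparr> Mod K2"
  define R where "R = H\<lparr>carrier := snd ` S\<rparr> Mod L2"
  define \<theta> where "\<theta> = (\<lambda>C\<in>carrier Q. {h. \<exists>g\<in>C. (g, h) \<in> S})"
  have Q: "carrier Q = (\<lambda>g. K2 #>\<^bsub>G\<^esub> g) ` fst ` S"
    using G.subquotient_carrier[OF KQ] by (simp add: Q_def K2_def)
  have R: "carrier R = (\<lambda>h. L2 #>\<^bsub>H\<^esub> h) ` snd ` S"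
    using H.subquotient_carrier[OF LQ] by (simp add: R_def L2_def)
  have Qm: "(K2 #>\<^bsub>G\<^esub> g) \<otimes>\<^bsub>Q\<^esub> (K2 #>\<^bsub>G\<^esub> g') = K2 #>\<^bsub>G\<^esub> (g \<otimes>\<^bsub>G\<^esub> g')"
    if "(g, h) \<in> S" "(g', h') \<in> S" for g h g' h'
    using G.subquotient_mult[OF KQ, of g g'] that by (force simp: Q_def K2_def)
  have Rm: "(L2 #>\<^bsub>H\<^esub> h) \<otimes>\<^bsub>R\<^esub> (L2 #>\<^bsub>H\<^esub> h') = L2 #>\<^bsub>H\<^esub> (h \<otimes>\<^bsub>H\<^esub> h')"
    if "(g, h) \<in> S" "(g', h') \<in> S" for g h g' h'
    using H.subquotient_mult[OF LQ, of h h'] that by (force simp: R_def L2_def)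
  have \<theta>: "\<theta> (K2 #>\<^bsub>G\<^esub> g) = L2 #>\<^bsub>H\<^esub> h" if "(g, h) \<in> S" for g h
  proof -
    have "K2 #>\<^bsub>G\<^esub> g \<in> carrier Q"
      using that by (force simp: Q)
    then show ?thesis
      using glue_map_coset[OF that] by (simp add: \<theta>_def K2_def L2_def)
  qed
  have ex: "\<exists>g h. (g, h) \<in> S \<and> C = K2 #>\<^bsub>G\<^esub> g" if "C \<in> carrier Q" for C
    using that by (force simp: Q)
  have inj: "C = D" if CD: "C \<in> carrier Q" "D \<in> carrier Q" "\<theta> C = \<theta> D" for C D
  proof -
    obtain g h g' h' where gh: "(g, h) \<in> S" "C = K2 #>\<^bsub>G\<^esub> g" "(g', h') \<in> S" "D = K2 #>\<^bsub>G\<^esub> g'"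
      using ex CD(1,2) by meson
    then have "L2 #>\<^bsub>H\<^esub> h = L2 #>\<^bsub>H\<^esub> h'"
      using \<theta> CD(3) by simp
    moreover have "h \<in> L2 #>\<^bsub>H\<^esub> h"
      using gh(1) S_coset_H_iff by (simp add: L2_def)
    \<comment> \<open>Equal images make \<open>h\<close> and \<open>h'\<close> partners of both
      \<open>g\<close> and \<open>g'\<close>; a shared partner puts \<open>g\<close> and
      \<open>g'\<close> into the same coset.\<close>
    ultimately have "(g', h) \<in> S"
      using S_coset_H_iff[OF gh(3), of h] by (simp add: L2_def)
    then have "(g, h') \<in> S"
      using S_coset_H_iff[OF gh(1), of h'] S_coset_H_iff[OF gh(3), of h'] gh(3)
        \<open>L2 #>\<^bsub>H\<^esub> h = L2 #>\<^bsub>H\<^esub> h'\<close> by (simp add: L2_def)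
    then have "g \<in> K2 #>\<^bsub>G\<^esub> g'"
      using S_coset_G_iff gh by (simp add: K2_def)
    moreover have "g \<in> fst ` S" "g' \<in> fst ` S"
      using gh by force+
    ultimately show ?thesis
      using G.subquotient_eq_iff[OF KQ, of g g'] gh by (simp add: K2_def)
  qed
  have "\<theta> \<in> hom Q R"
  proof (rule homI)
    show "\<theta> C \<in> carrier R" if "C \<in> carrier Q" for C
      using ex[OF that] \<theta> by (force simp: R)
    show "\<theta> (C \<otimes>\<^bsub>Q\<^esub> D) = \<theta> C \<otimes>\<^bsub>R\<^esub> \<theta> D" if CD: "C \<in> carrier Q" "D \<in> carrier Q" for C D
    proof -
      obtain g h g' h' where gh: "(g, h) \<in> S" "C = K2 #>\<^bsub>G\<^esub> g" "(g', h') \<in> S" "D = K2 #>\<^bsub>G\<^esub> g'"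
        using ex CD by meson
      then show ?thesis
        using \<theta> S_mult[OF gh(1,3)] Qm[OF gh(1,3)] Rm[OF gh(1,3)] by simp
    qed
  qed
  moreover have "bij_betw \<theta> (carrier Q) (carrier R)"
    unfolding bij_betw_def
  proof
    show "inj_on \<theta> (carrier Q)"
      using inj by (rule inj_onI)
    have "\<theta> ` carrier Q = (\<lambda>(g, h). \<theta> (K2 #>\<^bsub>G\<^esub> g)) ` S"
      by (force simp: Q image_image)
    also have "\<dots> = (\<lambda>(g, h). L2 #>\<^bsub>H\<^esub> h) ` S"
      using \<theta> by (intro image_cong) auto
    also have "\<dots> = carrier R"
      by (force simp: R image_image)
    finally show "\<theta> ` carrier Q = carrier R" .
  qed
  ultimately have "\<theta> \<in> group_isos Q R"
    by (simp add: group_isos_def iso_def \<theta>_def)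
  then show ?thesis
    by (simp add: \<theta>_def Q_def R_def K2_def L2_def)
qed

lemma glue_data_mem: "glue_data G H S \<in> goursat_data G H"
  using S_subgroups S_subgroups' glue_map_iso by (simp add: goursat_data_def glue_data_def)

text \<open>If \<open>h0\<close> is a partner of \<open>g\<close>, the glue map sends the coset of
  \<open>g\<close> to that of \<open>h0\<close>, and this coset consists of all partners of
  \<open>g\<close>.\<close>

lemma glue_graph_glue_data: "glue_graph G H (glue_data G H S) = S"
proof -
  note KQ = S_subgroups(1) S_subgroups'(1) and LQ = S_subgroups(2) S_subgroups'(2)
  have *: "{h'. \<exists>g'\<in>{g. (g, \<one>\<^bsub>H\<^esub>) \<in> S} #>\<^bsub>G\<^esub> g. (g', h') \<in> S} = {h. (\<one>\<^bsub>G\<^esub>, h) \<in> S} #>\<^bsub>H\<^esub> h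
      \<longleftrightarrow> (g, h) \<in> S" if "g \<in> fst ` S" "h \<in> snd ` S" for g h
  proof -
    obtain h0 where h0: "(g, h0) \<in> S"
      using \<open>g \<in> fst ` S\<close> by force
    then have "h0 \<in> snd ` S"
      by force
    then show ?thesis
      unfolding glue_map_coset[OF h0]
      using H.subquotient_eq_iff[OF LQ that(2), of h0] S_coset_H_iff[OF h0, of h] by auto
  qed
  have c: "{g. (g, \<one>\<^bsub>H\<^esub>) \<in> S} #>\<^bsub>G\<^esub> g \<in> carrier (G\<lparr>carrier := fst ` S\<rparr> Mod {g. (g, \<one>\<^bsub>H\<^esub>) \<in> S})"
    if "g \<in> fst ` S" for g
    unfolding G.subquotient_carrier[OF KQ] using that by (rule imageI)
  have "(g, h) \<in> glue_graph G H (glue_data G H S) \<longleftrightarrow> (g, h) \<in> S" for g h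
  proof -
    have "(g, h) \<in> glue_graph G H (glue_data G H S) \<longleftrightarrow> g \<in> fst ` S \<and> h \<in> snd ` S \<and> (g, h) \<in> S"
      unfolding glue_graph_def glue_data_def using * c by (simp cong: conj_cong)
    also have "\<dots> \<longleftrightarrow> (g, h) \<in> S"
      by force
    finally show ?thesis .
  qed
  then show ?thesis
    by auto
qed

end

lemma card_subgroups_DirProd:
  assumes finG: "finite (carrier G)" and finH: "finite (carrier H)"
  shows "card {S. subgroup S (G \<times>\<times> H)} =
    (\<Sum>K1\<in>{K. subgroup K G}. \<Sum>K2\<in>{K. subgroup K (G\<lparr>carrier := K1\<rparr>)}.
     \<Sum>L1\<in>{L. subgroup L H}. \<Sum>L2\<in>{L. subgroup L (H\<lparr>carrier := L1\<rparr>)}.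
       card (group_isos (G\<lparr>carrier := K1\<rparr> Mod K2) (H\<lparr>carrier := L1\<rparr> Mod L2)))"
proof -
  have "bij_betw (glue_graph G H) (goursat_data G H) {S. subgroup S (G \<times>\<times> H)}"
    by (rule bij_betw_byWitness[where f' = "glue_data G H"])
      (auto simp: glue_data_glue_graph glue_graph_glue_data subgroup_glue_graph glue_data_mem)
  then have "card {S. subgroup S (G \<times>\<times> H)} = card (goursat_data G H)"
    by (simp add: bij_betw_same_card)
  moreover
  have finK: "finite K" if "subgroup K G" for K
    using finG subgroup.subset[OF that] by (rule rev_finite_subset)
  have finL: "finite L" if "subgroup L H" for L
    using finH subgroup.subset[OF that] by (rule rev_finite_subset)
  note fin = finite_subgroups[OF finG] finite_subgroups[OF finH]
  have fin2: "finite {K. subgroup K (G\<lparr>carrier := K1\<rparr>)}" if "subgroup K1 G" for K1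
    using finK[OF that] by (intro finite_subgroups) simp
  have fin4: "finite {L. subgroup L (H\<lparr>carrier := L1\<rparr>)}" if "subgroup L1 H" for L1
    using finL[OF that] by (intro finite_subgroups) simp
  have fin5: "finite (group_isos (G\<lparr>carrier := K1\<rparr> Mod K2) (H\<lparr>carrier := L1\<rparr> Mod L2))"
    if "subgroup K1 G" "subgroup K2 (G\<lparr>carrier := K1\<rparr>)" "subgroup L1 H"
      "subgroup L2 (H\<lparr>carrier := L1\<rparr>)" for K1 K2 L1 L2
    using finK finL that
    by (intro finite_group_isos) (simp_all add: G.subquotient_carrier H.subquotient_carrier)
  have "card (goursat_data G H) =
    (\<Sum>K1\<in>{K. subgroup K G}. \<Sum>K2\<in>{K. subgroup K (G\<lparr>carrier := K1\<rparr>)}.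
     \<Sum>L1\<in>{L. subgroup L H}. \<Sum>L2\<in>{L. subgroup L (H\<lparr>carrier := L1\<rparr>)}.
       card (group_isos (G\<lparr>carrier := K1\<rparr> Mod K2) (H\<lparr>carrier := L1\<rparr> Mod L2)))"
    unfolding goursat_data_def
    by (intro sum.cong refl card_SigmaI[THEN trans] ballI finite_SigmaI)
      (simp_all add: fin fin2 fin4 fin5)
  ultimately show ?thesis
    by simp
qed

end

section \<open>Counting isomorphisms\<close>

text \<open>Both groups are quotients of the same integer lattice by the same sublattice, so sending
  \<open>f i j\<close> to \<open>g i j\<close> is well defined and injective.\<close>

lemma presentation_iso:
  assumes "presentation G f m n" "presentation H g m n"
  shows "G \<cong> H"
proof -
  interpret G: presentation G f m n by fact
  interpret H: presentation H g m n by fact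
  \<comment> \<open>An arbitrary preimage pair is chosen; \<open>f_eq_iff\<close>, with the same
    moduli in both groups, makes the value independent of the choice.\<close>
  define \<theta> where "\<theta> x = (case SOME z. x = f (fst z) (snd z) of (i, j) \<Rightarrow> g i j)" for x
  have \<theta>: "\<theta> (f i j) = g i j" for i j
  proof -
    have "f i j = f (fst z) (snd z)" if "z = (SOME z. f i j = f (fst z) (snd z))" for z
      unfolding that by (rule someI[of _ "(i, j)"]) simp
    then have "g (fst z) (snd z) = g i j" if "z = (SOME z. f i j = f (fst z) (snd z))" for z
      using that by (metis G.f_eq_iff H.f_eq_iff)
    then show ?thesis
      by (simp add: \<theta>_def case_prod_unfold)
  qed
  have "\<theta> \<in> hom G H"
  proof (rule homI)
    show "\<theta> x \<in> carrier H" if "x \<in> carrier G" for x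
      using G.f_surj[OF that] by (auto simp: \<theta>)
    show "\<theta> (x \<otimes>\<^bsub>G\<^esub> y) = \<theta> x \<otimes>\<^bsub>H\<^esub> \<theta> y" if "x \<in> carrier G" "y \<in> carrier G" for x y
      using G.f_surj[OF that(1)] G.f_surj[OF that(2)] by (auto simp: \<theta> H.f_add simp flip: G.f_add)
  qed
  moreover have "inj_on \<theta> (carrier G)"
    by (rule inj_onI) (auto dest!: G.f_surj simp: \<theta> G.f_eq_iff H.f_eq_iff)
  moreover have "\<theta> ` carrier G = carrier H"
  proof (intro equalityI subsetI)
    fix y
    assume "y \<in> carrier H"
    then obtain i j where "y = g i j"
      using H.f_surj by blast
    then show "y \<in> \<theta> ` carrier G"
      by (intro image_eqI[of _ _ "f i j"]) (simp_all add: \<theta>)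
  qed (auto dest!: G.f_surj simp: \<theta>)
  ultimately show ?thesis
    by (intro is_isoI[of \<theta>]) (simp add: iso_def bij_betw_def)
qed

lemma has_type_imp_iso:
  assumes "has_type G m n" "has_type H m n"
  shows "G \<cong> H"
  using assms presentation_iso unfolding has_type_def by blast

lemma comm_group_DirProd:
  assumes "comm_group G" "comm_group H"
  shows "comm_group (G \<times>\<times> H)"
proof -
  interpret G: comm_group G by fact
  interpret H: comm_group H by fact
  show ?thesis
    by (rule group.group_comm_groupI)
      (auto simp: DirProd_group G.is_group H.is_group G.m_comm H.m_comm)
qed

lemma has_type_integer_mod_groups:
  assumes "m > 0" "n > 0"
  shows "has_type (integer_mod_group m \<times>\<times> integer_mod_group n) (int m) (int n)"
proof -
  interpret comm_group "integer_mod_group m \<times>\<times> integer_mod_group n"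
    by (intro comm_group_DirProd abelian_integer_mod_group)
  have "presentation (integer_mod_group m \<times>\<times> integer_mod_group n)
      (\<lambda>i j. (i mod int m, j mod int n)) (int m) (int n)"
  proof
    show "\<exists>i j. x = (i mod int m, j mod int n)"
      if "x \<in> carrier (integer_mod_group m \<times>\<times> integer_mod_group n)" for x
      using that assms
      by (intro exI[of _ "fst x"] exI[of _ "snd x"]) (auto simp: carrier_integer_mod_group)
  qed (use assms in \<open>auto simp: carrier_integer_mod_group mod_add_eq\<close>)
  then show ?thesis
    by (auto simp: has_type_def)
qed

lemma has_type_card:
  assumes "has_type G (int m) (int n)" "m > 0" "n > 0"
  shows "card (carrier G) = m * n"
proof -
  have "G \<cong> integer_mod_group m \<times>\<times> integer_mod_group n"
    by (rule has_type_imp_iso[OF assms(1) has_type_integer_mod_groups[OF assms(2,3)]])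
  then have "card (carrier G) = card (carrier (integer_mod_group m \<times>\<times> integer_mod_group n))"
    by (rule iso_same_card)
  then show ?thesis
    using assms by (simp add: carrier_integer_mod_group)
qed

text \<open>As \<open>m dvd n\<close>, multiples of \<open>n\<close> annihilate both generators, and
  \<open>f 0 1\<close> detects all other integers. Stating this for each \<open>k\<close> encodes
  the exponent by the integers that annihilate the group.\<close>

lemma has_type_exponent:
  assumes "has_type G m n" "m dvd n"
  shows "(\<forall>x\<in>carrier G. x [^]\<^bsub>G\<^esub> (k::int) = \<one>\<^bsub>G\<^esub>) \<longleftrightarrow> n dvd k"
proof -
  obtain f where "presentation G f m n"
    using assms by (auto simp: has_type_def)
  then interpret presentation G f m n .
  have "(\<forall>x\<in>carrier G. x [^]\<^bsub>G\<^esub> k = \<one>\<^bsub>G\<^esub>) \<longleftrightarrow> (\<forall>i j. f i j [^]\<^bsub>G\<^esub> k = \<one>\<^bsub>G\<^esub>)"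
    using f_surj by (metis f_closed)
  also have "\<dots> \<longleftrightarrow> (\<forall>i j. m dvd k * i \<and> n dvd k * j)"
    by (simp add: f_one_iff flip: f_int_pow)
  also have "\<dots> \<longleftrightarrow> n dvd k"
    using assms(2) by (metis dvd_mult2 dvd_trans mult.right_neutral)
  finally show ?thesis .
qed

lemma iso_exponent:
  assumes "G \<cong> H" "group G" "group H"
  shows "(\<forall>x\<in>carrier G. x [^]\<^bsub>G\<^esub> (k::int) = \<one>\<^bsub>G\<^esub>) \<longleftrightarrow> (\<forall>y\<in>carrier H. y [^]\<^bsub>H\<^esub> k = \<one>\<^bsub>H\<^esub>)"
proof -
  obtain \<theta> where \<theta>: "\<theta> \<in> iso G H"
    using assms(1) by (auto simp: is_iso_def)
  interpret group_hom G H \<theta>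
    using assms \<theta> by (simp add: group_hom_def group_hom_axioms_def iso_def)
  have surj: "\<theta> ` carrier G = carrier H" and inj: "inj_on \<theta> (carrier G)"
    using \<theta> by (auto simp: iso_def bij_betw_def)
  have "\<theta> x [^]\<^bsub>H\<^esub> k = \<one>\<^bsub>H\<^esub> \<longleftrightarrow> x [^]\<^bsub>G\<^esub> k = \<one>\<^bsub>G\<^esub>" if "x \<in> carrier G" for x
    using inj_on_eq_iff[OF inj, of "x [^]\<^bsub>G\<^esub> k" "\<one>\<^bsub>G\<^esub>"] that by (simp add: hom_int_pow)
  then show ?thesis
    unfolding surj[symmetric] by simp
qed

text \<open>The orderings make \<open>p ^ v\<close> and \<open>p ^ v'\<close> the exponents, so
  \<open>v = v'\<close>; comparing the group orders then gives \<open>u = u'\<close>.\<close>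

lemma has_type_unique:
  assumes "prime p" and G: "has_type G (int p ^ u) (int p ^ v)" and H: "has_type H (int p ^ u') (int p ^ v')"
    and "G \<cong> H" "u \<le> v" "u' \<le> v'"
  shows "u = u' \<and> v = v'"
proof -
  have p: "p > 1"
    using \<open>prime p\<close> by (rule prime_gt_1_nat)
  have "comm_group G" "comm_group H"
    using G H by (auto simp: has_type_def presentation_def)
  then have dvd_iff: "int p ^ v dvd k \<longleftrightarrow> int p ^ v' dvd k" for k
    using has_type_exponent[OF G le_imp_power_dvd[OF \<open>u \<le> v\<close>]]
      has_type_exponent[OF H le_imp_power_dvd[OF \<open>u' \<le> v'\<close>]]
      iso_exponent[OF \<open>G \<cong> H\<close>] comm_group.axioms(2) by metis
  have "int p ^ v = int p ^ v'"
    using dvd_iff[of "int p ^ v"] dvd_iff[of "int p ^ v'"]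
    by (intro zdvd_antisym_nonneg) simp_all
  then have "v = v'"
    using p by (simp flip: of_nat_power)
  moreover have "p ^ u * p ^ v = p ^ u' * p ^ v'"
    using has_type_card[of G "p ^ u" "p ^ v"] has_type_card[of H "p ^ u'" "p ^ v'"]
      G H iso_same_card[OF \<open>G \<cong> H\<close>] p by simp
  then have "p ^ (u + v) = p ^ (u' + v')"
    by (simp add: power_add)
  then have "u + v = u' + v'"
    using p by simp
  ultimately show ?thesis
    by simp
qed

section \<open>Isomorphism counts as invariants of the types\<close>

lemma group_isos_transport:
  assumes \<alpha>: "\<alpha> \<in> iso A' A" and \<beta>: "\<beta> \<in> iso B B'" and \<theta>: "\<theta> \<in> group_isos A B"
    and "group A'"
  shows "(\<lambda>x\<in>carrier A'. \<beta> (\<theta> (\<alpha> x))) \<in> group_isos A' B'"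
proof -
  have "\<beta> \<circ> (\<theta> \<circ> \<alpha>) \<in> iso A' B'"
    using \<theta> by (intro iso_set_trans[OF iso_set_trans[OF \<alpha>] \<beta>]) (simp add: group_isos_def)
  moreover have "x \<otimes>\<^bsub>A'\<^esub> y \<in> carrier A'" if "x \<in> carrier A'" "y \<in> carrier A'" for x y
    using that \<open>group A'\<close> by (simp add: group.is_monoid monoid.m_closed)
  ultimately have "(\<lambda>x\<in>carrier A'. \<beta> (\<theta> (\<alpha> x))) \<in> iso A' B'"
    by (auto simp: iso_def hom_def Pi_iff o_def cong: bij_betw_cong)
  then show ?thesis
    by (simp add: group_isos_def)
qed

text \<open>Composing with \<open>\<beta>\<close> and the inverse of \<open>\<alpha>\<close> is
  undone by the reverse composition. Restriction to the carriers makes the two maps inverse to each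
  other as functions, also outside the carriers.\<close>

lemma card_group_isos_cong:
  assumes "A \<cong> A'" "B \<cong> B'" "group A" "group A'" "group B" "group B'"
  shows "card (group_isos A B) = card (group_isos A' B')"
proof -
  obtain \<alpha> \<beta> where \<alpha>: "\<alpha> \<in> iso A A'" and \<beta>: "\<beta> \<in> iso B B'"
    using assms by (auto simp: is_iso_def)
  define \<alpha>' where "\<alpha>' = inv_into (carrier A) \<alpha>"
  define \<beta>' where "\<beta>' = inv_into (carrier B) \<beta>"
  have \<alpha>': "\<alpha>' \<in> iso A' A" and \<beta>': "\<beta>' \<in> iso B' B"
    using assms \<alpha> \<beta> by (simp_all add: \<alpha>'_def \<beta>'_def group.iso_set_sym)
  have inv: "\<alpha> x \<in> carrier A'" "\<alpha>' (\<alpha> x) = x" if "x \<in> carrier A" for x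
    using \<alpha> that by (auto simp: \<alpha>'_def iso_def bij_betw_def)
  have inv': "\<alpha>' x \<in> carrier A" "\<alpha> (\<alpha>' x) = x" if "x \<in> carrier A'" for x
    using \<alpha> that by (auto simp: \<alpha>'_def iso_def bij_betw_def f_inv_into_f inv_into_into)
  have binv: "\<beta>' (\<beta> x) = x" if "x \<in> carrier B" for x
    using \<beta> that by (auto simp: \<beta>'_def iso_def bij_betw_def)
  have binv': "\<beta> (\<beta>' x) = x" if "x \<in> carrier B'" for x
    using \<beta> that by (auto simp: \<beta>'_def iso_def bij_betw_def f_inv_into_f)
  have cl: "\<theta> x \<in> carrier B" if "\<theta> \<in> group_isos A B" "x \<in> carrier A" for \<theta> x
    using that by (auto simp: group_isos_def iso_def hom_def)
  have cl': "\<theta> x \<in> carrier B'" if "\<theta> \<in> group_isos A' B'" "x \<in> carrier A'" for \<theta> x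
    using that by (auto simp: group_isos_def iso_def hom_def)
  have ext: "\<theta> x = undefined" if "\<theta> \<in> group_isos A B" "x \<notin> carrier A" for \<theta> x
    using that by (auto simp: group_isos_def extensional_def)
  have ext': "\<theta> x = undefined" if "\<theta> \<in> group_isos A' B'" "x \<notin> carrier A'" for \<theta> x
    using that by (auto simp: group_isos_def extensional_def)
  have "bij_betw (\<lambda>\<theta>. \<lambda>x\<in>carrier A'. \<beta> (\<theta> (\<alpha>' x))) (group_isos A B) (group_isos A' B')"
  proof (rule bij_betw_byWitness[where f' = "\<lambda>\<theta>. \<lambda>x\<in>carrier A. \<beta>' (\<theta> (\<alpha> x))"])
    show "\<forall>\<theta>\<in>group_isos A B. (\<lambda>x\<in>carrier A. \<beta>' ((\<lambda>x\<in>carrier A'. \<beta> (\<theta> (\<alpha>' x))) (\<alpha> x))) = \<theta>"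
      by (auto simp: fun_eq_iff inv binv cl ext)
    show "\<forall>\<theta>\<in>group_isos A' B'. (\<lambda>x\<in>carrier A'. \<beta> ((\<lambda>x\<in>carrier A. \<beta>' (\<theta> (\<alpha> x))) (\<alpha>' x))) = \<theta>"
      by (auto simp: fun_eq_iff inv' binv' cl' ext')
  qed (use group_isos_transport[OF \<alpha>' \<beta> _ \<open>group A'\<close>] group_isos_transport[OF \<alpha> \<beta>' _ \<open>group A\<close>] in auto)
  then show ?thesis
    by (rule bij_betw_same_card)
qed

lemma auto_eq_group_isos: "auto G = group_isos G G"
  by (auto simp: auto_def group_isos_def Bij_def iso_def)

text \<open>For equal exponents both groups can be replaced by the same product of residue groups,
  so isomorphisms become automorphisms. For different exponents \<open>has_type_unique\<close> rules
  out any isomorphism.\<close>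

lemma card_group_isos_has_type:
  assumes "prime p" and A: "has_type A (int p ^ u) (int p ^ v)" and B: "has_type B (int p ^ u') (int p ^ v')"
    and "u \<le> v" "u' \<le> v'"
  shows "card (group_isos A B) = (if u = u' \<and> v = v' then num_automorphisms2 (p ^ u) (p ^ v) else 0)"
proof (cases "u = u' \<and> v = v'")
  case True
  have p: "p > 0"
    using \<open>prime p\<close> by (rule prime_gt_0_nat)
  let ?T = "integer_mod_group (p ^ u) \<times>\<times> integer_mod_group (p ^ v)"
  have T: "has_type ?T (int p ^ u) (int p ^ v)"
    using has_type_integer_mod_groups[of "p ^ u" "p ^ v"] p by simp
  have grp: "group A" "group B" "group ?T"
    using A B T by (auto simp: has_type_def presentation_def comm_group_def)
  have "A \<cong> ?T" "B \<cong> ?T"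
    using A B T True by (auto intro: has_type_imp_iso)
  then show ?thesis
    using True grp card_group_isos_cong[of A ?T B ?T]
    by (simp add: num_automorphisms2_def auto_eq_group_isos)
next
  case False
  then have "\<not> A \<cong> B"
    using has_type_unique[OF \<open>prime p\<close> A B] assms by blast
  then have empty: "group_isos A B = {}"
    by (auto simp: group_isos_def is_iso_def)
  show ?thesis
    unfolding if_not_P[OF False] empty by simp
qed

section \<open>Counting subgroups\<close>

lemma iso_card_subgroups:
  assumes \<theta>: "\<theta> \<in> iso G H" and "group G" "group H"
  shows "card {K. subgroup K G} = card {K. subgroup K H}"
proof (rule bij_betw_same_card)
  define \<theta>' where "\<theta>' = inv_into (carrier G) \<theta>"
  have \<theta>': "\<theta>' \<in> iso H G"
    unfolding \<theta>'_def using \<open>group G\<close> \<theta> by (rule group.iso_set_sym)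
  have bij: "bij_betw \<theta> (carrier G) (carrier H)"
    using \<theta> by (simp add: iso_def)
  interpret \<theta>: group_hom G H \<theta>
    using assms by (simp add: group_hom_def group_hom_axioms_def iso_def)
  interpret \<theta>': group_hom H G \<theta>'
    using assms \<theta>' by (simp add: group_hom_def group_hom_axioms_def iso_def)
  show "bij_betw (\<lambda>K. \<theta> ` K) {K. subgroup K G} {K. subgroup K H}"
  proof (rule bij_betw_byWitness[where f' = "\<lambda>K. \<theta>' ` K"])
    show "\<forall>K\<in>{K. subgroup K G}. \<theta>' ` \<theta> ` K = K"
      using bij by (simp add: \<theta>'_def bij_betw_def inv_into_image_cancel subgroup.subset)
    show "\<forall>K\<in>{K. subgroup K H}. \<theta> ` \<theta>' ` K = K"
      using bij by (simp add: \<theta>'_def bij_betw_def image_inv_into_cancel subgroup.subset)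
  qed (auto intro: \<theta>.subgroup_img_is_subgroup \<theta>'.subgroup_img_is_subgroup)
qed

text \<open>
  The operator \<open>\<times>\<times>\<close> associates to the right, so the library's \<open>DirProd_assoc_iso_set\<close> only
  concerns the identity map.
\<close>

lemma DirProd_assoc_iso: "(\<lambda>((x, y), z). (x, (y, z))) \<in> iso ((G \<times>\<times> H) \<times>\<times> I) (G \<times>\<times> (H \<times>\<times> I))"
  by (auto simp: iso_def hom_def bij_betw_def inj_on_def image_def)

text \<open>The summand is constant in the unit \<open>w\<close>, so summing over \<open>w\<close>
  contributes the factor \<open>totient (p ^ x3)\<close>. The assumption on \<open>F\<close> offers
  the types of both the subgroup and the quotient: the first serves the choice of \<open>K1\<close>,
  the second the choice of \<open>K2\<close> inside it.\<close>

lemma sum_subgroups: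
  fixes g :: "nat \<times> nat \<times> nat \<times> nat \<times> nat \<Rightarrow> nat"
  assumes "prime p" "has_type G (int p ^ a) (int p ^ b)"
    and F: "\<And>K x1 x2 x3 x4 x5. \<lbrakk>subgroup K G;
      has_type (G\<lparr>carrier := K\<rparr>) (int p ^ min x1 x4) (int p ^ (x3 + max x1 x4));
      has_type (G Mod K) (int p ^ min x2 x5) (int p ^ (x3 + max x2 x5))\<rbrakk>
      \<Longrightarrow> F K = g (x1, x2, x3, x4, x5)"
  shows "(\<Sum>K\<in>{K. subgroup K G}. F K) =
    (\<Sum>(x1, x2, x3, x4, x5)\<in>index_tuples a b. totient (p ^ x3) * g (x1, x2, x3, x4, x5))"
proof -
  obtain f where "presentation G f (int p ^ a) (int p ^ b)"
    using assms by (auto simp: has_type_def)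
  then interpret p_presentation G f p a b
    using \<open>prime p\<close> by (simp add: p_presentation_def p_presentation_axioms_def)
  let ?W = "\<lambda>x :: nat \<times> nat \<times> nat \<times> nat \<times> nat. case x of (x1, x2, x3, x4, x5) \<Rightarrow> totatives (p ^ x3)"
  have "(\<Sum>K\<in>{K. subgroup K G}. F K) = (\<Sum>(x, w)\<in>Sigma (index_tuples a b) ?W. F (glued_subgroup x w))"
    by (rule sum.reindex_bij_betw[OF bij_betw_glued_subgroup, symmetric, THEN trans])
      (simp add: case_prod_unfold)
  also have "\<dots> = (\<Sum>(x, w)\<in>Sigma (index_tuples a b) ?W. g x)"
    by (rule sum.cong) (auto intro!: F subgroup_glued_subgroup has_type_glued_subgroup has_type_glued_quotient)
  also have "\<dots> = (\<Sum>x\<in>index_tuples a b. \<Sum>w\<in>?W x. g x)"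
    by (rule sum.Sigma[symmetric]) auto
  also have "\<dots> = (\<Sum>(x1, x2, x3, x4, x5)\<in>index_tuples a b. totient (p ^ x3) * g (x1, x2, x3, x4, x5))"
    by (rule sum.cong) (auto simp: totient_def)
  finally show ?thesis .
qed

text \<open>These are the index tuples of the subgroups of a subgroup with index tuple
  \<open>x\<close>; the two arguments are the exponents found in
  \<open>has_type_glued_subgroup\<close>.\<close>

definition subgroup_types :: "nat \<times> nat \<times> nat \<times> nat \<times> nat \<Rightarrow> (nat \<times> nat \<times> nat \<times> nat \<times> nat) set" where
  "subgroup_types = (\<lambda>(x1, x2, x3, x4, x5). index_tuples (min x1 x4) (x3 + max x1 x4))"

lemma finite_subgroup_types [simp]: "finite (subgroup_types x)"
  by (simp add: subgroup_types_def split: prod.split)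

text \<open>Apply \<open>sum_subgroups\<close> to \<open>G\<close>, and then inside each
  \<open>K1\<close>, whose type is known from its index tuple. The type of \<open>K1 / K2\<close>
  has ordered exponents, which provides the premise \<open>u \<le> v\<close> for
  \<open>F\<close>.\<close>

lemma sum_subquotients:
  fixes g :: "nat \<Rightarrow> nat \<Rightarrow> nat"
  assumes p: "prime p" and G: "has_type G (int p ^ a) (int p ^ b)"
    and F: "\<And>K1 K2 u v. \<lbrakk>subgroup K1 G; subgroup K2 (G\<lparr>carrier := K1\<rparr>); u \<le> v;
      has_type (G\<lparr>carrier := K1\<rparr> Mod K2) (int p ^ u) (int p ^ v)\<rbrakk> \<Longrightarrow> F K1 K2 = g u v"
  shows "(\<Sum>K1\<in>{K. subgroup K G}. \<Sum>K2\<in>{K. subgroup K (G\<lparr>carrier := K1\<rparr>)}. F K1 K2) =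
    (\<Sum>x\<in>index_tuples a b. \<Sum>y\<in>subgroup_types x.
      (case (x, y) of ((x1, x2, x3, x4, x5), (y1, y2, y3, y4, y5)) \<Rightarrow>
        totient (p ^ x3) * totient (p ^ y3) * g (min y2 y5) (y3 + max y2 y5)))"
proof -
  have "(\<Sum>K1\<in>{K. subgroup K G}. \<Sum>K2\<in>{K. subgroup K (G\<lparr>carrier := K1\<rparr>)}. F K1 K2) =
    (\<Sum>(x1, x2, x3, x4, x5)\<in>index_tuples a b. totient (p ^ x3) *
      (\<lambda>x. \<Sum>(y1, y2, y3, y4, y5)\<in>subgroup_types x.
         totient (p ^ y3) * g (min y2 y5) (y3 + max y2 y5)) (x1, x2, x3, x4, x5))"
  proof (rule sum_subgroups[OF p G])
    fix K1 x1 x2 x3 x4 x5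
    assume K1: "subgroup K1 G"
      and type: "has_type (G\<lparr>carrier := K1\<rparr>) (int p ^ min x1 x4) (int p ^ (x3 + max x1 x4))"
    have "(\<Sum>K2\<in>{K. subgroup K (G\<lparr>carrier := K1\<rparr>)}. F K1 K2) =
      (\<Sum>(y1, y2, y3, y4, y5)\<in>index_tuples (min x1 x4) (x3 + max x1 x4).
         totient (p ^ y3) * (\<lambda>(y1, y2, y3, y4, y5). g (min y2 y5) (y3 + max y2 y5)) (y1, y2, y3, y4, y5))"
      by (rule sum_subgroups[OF p type]) (use K1 in \<open>auto intro!: F\<close>)
    then show "(\<Sum>K2\<in>{K. subgroup K (G\<lparr>carrier := K1\<rparr>)}. F K1 K2) =
      (\<lambda>x. \<Sum>(y1, y2, y3, y4, y5)\<in>subgroup_types x.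
         totient (p ^ y3) * g (min y2 y5) (y3 + max y2 y5)) (x1, x2, x3, x4, x5)"
      by (simp add: subgroup_types_def)
  qed
  also have "\<dots> = (\<Sum>x\<in>index_tuples a b. \<Sum>y\<in>subgroup_types x.
      (case (x, y) of ((x1, x2, x3, x4, x5), (y1, y2, y3, y4, y5)) \<Rightarrow>
        totient (p ^ x3) * totient (p ^ y3) * g (min y2 y5) (y3 + max y2 y5)))"
    by (intro sum.cong refl) (auto simp: sum_distrib_left mult.assoc intro!: sum.cong)
  finally show ?thesis .
qed

text \<open>The isomorphism count vanishes unless the types of the two quotients agree. This moves
  that condition, which couples only \<open>y\<close> and \<open>t\<close>, into the index
  set.\<close>

lemma sum4_filter:
  fixes h :: "'x \<Rightarrow> 'y \<Rightarrow> 'z \<Rightarrow> 't \<Rightarrow> nat"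
  assumes "finite A" "\<And>x. finite (B x)" "finite C" "\<And>z. finite (D z)"
  shows "(\<Sum>x\<in>A. \<Sum>y\<in>B x. \<Sum>z\<in>C. \<Sum>t\<in>D z. if P y t then h x y z t else 0) =
    (\<Sum>(x, y, z, t)\<in>{(x, y, z, t). x \<in> A \<and> y \<in> B x \<and> z \<in> C \<and> t \<in> D z \<and> P y t}. h x y z t)"
proof -
  let ?S = "SIGMA x:A. SIGMA y:B x. SIGMA z:C. D z"
  have "(\<Sum>x\<in>A. \<Sum>y\<in>B x. \<Sum>z\<in>C. \<Sum>t\<in>D z. if P y t then h x y z t else 0) =
      (\<Sum>(x, y, z, t)\<in>?S. if P y t then h x y z t else 0)"
    using assms by (simp add: sum.Sigma finite_SigmaI)
  also have "\<dots> = (\<Sum>s\<in>?S. if (case s of (x, y, z, t) \<Rightarrow> P y t)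
      then (case s of (x, y, z, t) \<Rightarrow> h x y z t) else 0)"
    by (rule sum.cong) auto
  also have "\<dots> = (\<Sum>s\<in>{s \<in> ?S. case s of (x, y, z, t) \<Rightarrow> P y t}. case s of (x, y, z, t) \<Rightarrow> h x y z t)"
    using assms by (intro sum.inter_filter[symmetric] finite_SigmaI)
  also have "{s \<in> ?S. case s of (x, y, z, t) \<Rightarrow> P y t} =
      {(x, y, z, t). x \<in> A \<and> y \<in> B x \<and> z \<in> C \<and> t \<in> D z \<and> P y t}"
    by auto
  finally show ?thesis .
qed

section \<open>Assembly of the formula\<close>

theorem corollary7:
  fixes p a b c d :: nat
  assumes "Factorial_Ring.prime p"
  shows "num_subgroups4 (p ^ a) (p ^ b) (p ^ c) (p ^ d) =
    (\<Sum>(x1, x2, x3, x4, x5, y1, y2, y3, y4, y5, z1, z2, z3, z4, z5, t1, t2, t3, t4, t5) \<in>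
        {(x1, x2, x3, x4, x5, y1, y2, y3, y4, y5, z1, z2, z3, z4, z5, t1, t2, t3, t4, t5).
           x1 + x2 + x3 = a \<and>
           x3 + x4 + x5 = b \<and>
           y1 + y2 + y3 = min x1 x4 \<and>
           y3 + y4 + y5 = x3 + max x1 x4 \<and>
           z1 + z2 + z3 = c \<and>
           z3 + z4 + z5 = d \<and>
           t1 + t2 + t3 = min z1 z4 \<and>
           t3 + t4 + t5 = z3 + max z1 z4 \<and>
           min y2 y5 = min t2 t5 \<and>
           y3 + max y2 y5 = t3 + max t2 t5}.
       let u = min y2 y5; v = y3 + max y2 y5
       in totient (p ^ x3) * totient (p ^ y3) * totient (p ^ z3) * totient (p ^ t3)
            * num_automorphisms2 (p ^ u) (p ^ v))"
proof -
  have p: "p > 0"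
    using assms by (rule prime_gt_0_nat)
  define G where "G = integer_mod_group (p ^ a) \<times>\<times> integer_mod_group (p ^ b)"
  define H where "H = integer_mod_group (p ^ c) \<times>\<times> integer_mod_group (p ^ d)"
  have G: "has_type G (int p ^ a) (int p ^ b)" and H: "has_type H (int p ^ c) (int p ^ d)"
    using has_type_integer_mod_groups[of "p ^ a" "p ^ b"]
      has_type_integer_mod_groups[of "p ^ c" "p ^ d"] p by (simp_all add: G_def H_def)
  interpret comm_group_pair G H
    unfolding comm_group_pair_def G_def H_def by (simp add: comm_group_DirProd)
  have fin: "finite (carrier G)" "finite (carrier H)"
    using p by (simp_all add: G_def H_def carrier_integer_mod_group)
  \<comment> \<open>This is the contribution of a chain in \<open>H\<close> when the quotient on the
    \<open>G\<close> side has type \<open>u\<close>, \<open>v\<close>; the conditional carries the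
    last two conditions on the tuple.\<close>
  define h where "h u v z t = (case (z, t) of ((z1, z2, z3, z4, z5), (t1, t2, t3, t4, t5)) \<Rightarrow>
      totient (p ^ z3) * totient (p ^ t3) *
      (if u = min t2 t5 \<and> v = t3 + max t2 t5 then num_automorphisms2 (p ^ u) (p ^ v) else 0))"
    for u v and z t :: "nat \<times> nat \<times> nat \<times> nat \<times> nat"
  \<comment> \<open>The fourfold product is nested to the right, so it is first regrouped into two
    pairs.\<close>
  have "num_subgroups4 (p ^ a) (p ^ b) (p ^ c) (p ^ d) = card {S. subgroup S (G \<times>\<times> H)}"
    unfolding num_subgroups4_def G_def H_def
    by (intro iso_card_subgroups[OF DirProd_assoc_iso, symmetric] DirProd_group group_integer_mod_group)
  also have "\<dots> = (\<Sum>K1\<in>{K. subgroup K G}. \<Sum>K2\<in>{K. subgroup K (G\<lparr>carrier := K1\<rparr>)}.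
     \<Sum>L1\<in>{L. subgroup L H}. \<Sum>L2\<in>{L. subgroup L (H\<lparr>carrier := L1\<rparr>)}.
       card (group_isos (G\<lparr>carrier := K1\<rparr> Mod K2) (H\<lparr>carrier := L1\<rparr> Mod L2)))"
    using fin by (rule card_subgroups_DirProd)
  also have "\<dots> = (\<Sum>x\<in>index_tuples a b. \<Sum>y\<in>subgroup_types x.
      (case (x, y) of ((x1, x2, x3, x4, x5), (y1, y2, y3, y4, y5)) \<Rightarrow>
        totient (p ^ x3) * totient (p ^ y3) *
        (\<Sum>z\<in>index_tuples c d. \<Sum>t\<in>subgroup_types z. h (min y2 y5) (y3 + max y2 y5) z t)))"
  \<comment> \<open>For a fixed chain in \<open>G\<close>, the inner double sum depends only on the
    type of the quotient; the same counting lemma for \<open>H\<close> evaluates it.\<close>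
  proof (rule sum_subquotients[OF assms G])
    fix K1 K2 and u v :: nat
    assume "u \<le> v" and K: "has_type (G\<lparr>carrier := K1\<rparr> Mod K2) (int p ^ u) (int p ^ v)"
    show "(\<Sum>L1\<in>{L. subgroup L H}. \<Sum>L2\<in>{L. subgroup L (H\<lparr>carrier := L1\<rparr>)}.
       card (group_isos (G\<lparr>carrier := K1\<rparr> Mod K2) (H\<lparr>carrier := L1\<rparr> Mod L2))) =
       (\<Sum>z\<in>index_tuples c d. \<Sum>t\<in>subgroup_types z. h u v z t)"
      unfolding h_def
      by (rule sum_subquotients[OF assms H])
        (rule card_group_isos_has_type[OF assms K _ \<open>u \<le> v\<close>])
  qed
  also have "\<dots> = (\<Sum>x\<in>index_tuples a b. \<Sum>y\<in>subgroup_types x.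
      \<Sum>z\<in>index_tuples c d. \<Sum>t\<in>subgroup_types z.
      if (case (y, t) of ((y1, y2, y3, y4, y5), (t1, t2, t3, t4, t5)) \<Rightarrow>
        min y2 y5 = min t2 t5 \<and> y3 + max y2 y5 = t3 + max t2 t5)
      then (case (x, y, z, t) of ((x1, x2, x3, x4, x5), (y1, y2, y3, y4, y5),
            (z1, z2, z3, z4, z5), (t1, t2, t3, t4, t5)) \<Rightarrow>
          totient (p ^ x3) * totient (p ^ y3) * totient (p ^ z3) * totient (p ^ t3)
            * num_automorphisms2 (p ^ min y2 y5) (p ^ (y3 + max y2 y5)))
      else 0)"
    by (intro sum.cong refl)
      (clarsimp simp: sum_distrib_left h_def, intro sum.cong refl, clarsimp)
  also note sum4_filter[OF finite_index_tuples finite_subgroup_types finite_index_tuples finite_subgroup_types]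
  also have "(\<Sum>(x, y, z, t)\<in>{(x, y, z, t). x \<in> index_tuples a b \<and> y \<in> subgroup_types x \<and>
          z \<in> index_tuples c d \<and> t \<in> subgroup_types z \<and>
          (case (y, t) of ((y1, y2, y3, y4, y5), (t1, t2, t3, t4, t5)) \<Rightarrow>
            min y2 y5 = min t2 t5 \<and> y3 + max y2 y5 = t3 + max t2 t5)}.
      (case (x, y, z, t) of ((x1, x2, x3, x4, x5), (y1, y2, y3, y4, y5),
            (z1, z2, z3, z4, z5), (t1, t2, t3, t4, t5)) \<Rightarrow>
          totient (p ^ x3) * totient (p ^ y3) * totient (p ^ z3) * totient (p ^ t3)
            * num_automorphisms2 (p ^ min y2 y5) (p ^ (y3 + max y2 y5)))) =
    (\<Sum>(x1, x2, x3, x4, x5, y1, y2, y3, y4, y5, z1, z2, z3, z4, z5, t1, t2, t3, t4, t5) \<in>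
        {(x1, x2, x3, x4, x5, y1, y2, y3, y4, y5, z1, z2, z3, z4, z5, t1, t2, t3, t4, t5).
           x1 + x2 + x3 = a \<and>
           x3 + x4 + x5 = b \<and>
           y1 + y2 + y3 = min x1 x4 \<and>
           y3 + y4 + y5 = x3 + max x1 x4 \<and>
           z1 + z2 + z3 = c \<and>
           z3 + z4 + z5 = d \<and>
           t1 + t2 + t3 = min z1 z4 \<and>
           t3 + t4 + t5 = z3 + max z1 z4 \<and>
           min y2 y5 = min t2 t5 \<and>
           y3 + max y2 y5 = t3 + max t2 t5}.
       let u = min y2 y5; v = y3 + max y2 y5
       in totient (p ^ x3) * totient (p ^ y3) * totient (p ^ z3) * totient (p ^ t3)
            * num_automorphisms2 (p ^ u) (p ^ v))"
    \<comment> \<open>Four quintuples are flattened into one 20-tuple and back.\<close>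
    by (rule sum.reindex_bij_witness[where
        i = "\<lambda>(x1, x2, x3, x4, x5, y1, y2, y3, y4, y5, z1, z2, z3, z4, z5, t1, t2, t3, t4, t5).
          ((x1, x2, x3, x4, x5), (y1, y2, y3, y4, y5), (z1, z2, z3, z4, z5), (t1, t2, t3, t4, t5))"
        and j = "\<lambda>((x1, x2, x3, x4, x5), (y1, y2, y3, y4, y5), (z1, z2, z3, z4, z5), (t1, t2, t3, t4, t5)).
          (x1, x2, x3, x4, x5, y1, y2, y3, y4, y5, z1, z2, z3, z4, z5, t1, t2, t3, t4, t5)"])
      (clarsimp simp: index_tuples_def subgroup_types_def Let_def)+
  finally show ?thesis .
qed

end
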